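(* Let $\mathbb{H}$ be a Hilbert space. One observes a realization of the Gaussian random vector $\boldsymbol{y}=A\boldsymbol{\theta}+\epsilon_n\boldsymbol{\xi}$, where $\epsilon_n>0$, $\epsilon_n\to0$ as $n\to\infty$, $A:\mathbb{H}\to\mathbb{H}$ is a known linear operator, and $\boldsymbol{\xi}$ is a Gaussian random vector with $\mathbf{E}[\boldsymbol{\xi}]=0$ and known covariance operator $R:\mathbb{H}\to\mathbb{H}$. Suppose that the nullspaces of $A$ and $R$ equal zero, that the range of $A$ is contained in the range of $R^{1/2}$, and that the operator $R^{-1/2}A$ is bounded. Suppose that the bounded set $U\subset\mathbb{H}$ is convex and that $\boldsymbol{0}$ is an inner point of $U$. For $\rho_n>0$ put $V_n=\{\boldsymbol{\theta}:\|\boldsymbol{\theta}\|\ge\rho_n,\ \boldsymbol{\theta}\in U\}$. Then there is a sequence $\rho_n\to0$ as $n\to\infty$ such that there is a uniformly consistent sequence of tests of the hypothesis $\boldsymbol{\theta}=\boldsymbol{0}$ versus the alternatives $\boldsymbol{\theta}\in V_n$ (with this sequence $\rho_n$) if and only if the set $U$ is relatively compact in $\mathbb{H}$.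
   Context: The point $\boldsymbol{0}$ is called an inner point of $U$ if for any $\boldsymbol{y}\in\mathbb{H}$ there is $\lambda>0$ such that $\lambda\boldsymbol{y}\in U$ and $-\lambda\boldsymbol{y}\in U$. For a test $K_n$ (a measurable function of the observation with values in $[0,1]$, the probability of rejecting the hypothesis), $\alpha(K_n)$ is its type I error probability, $\beta(K_n,\boldsymbol{\theta})$ its type II error probability at $\boldsymbol{\theta}$, and $\beta(K_n,V_n)=\sup_{\boldsymbol{\theta}\in V_n}\beta(K_n,\boldsymbol{\theta})$. A sequence of tests $K_n$ with $\alpha(K_n)=\alpha+o(1)$, $0<\alpha<1$, is uniformly consistent for the sets $V_n$ if $\limsup_{n\to\infty}\beta(K_n,V_n)<1-\alpha$. Existence is understood among all tests. *)

theory Defs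
  imports "HOL-Probability.Probability"
begin

text \<open>
  Throughout, a (real) Hilbert space is a type of sort \<open>{real_inner, complete_space}\<close>;
  neither separability nor infinite dimension is assumed.
\<close>

subsection \<open>Operators\<close>

definition positive_operator :: "('h::real_inner \<Rightarrow> 'h) \<Rightarrow> bool" where
  "positive_operator T \<longleftrightarrow>
     bounded_linear T \<and> (\<forall>x y. T x \<bullet> y = x \<bullet> T y) \<and> (\<forall>x. 0 \<le> T x \<bullet> x)"

text \<open>
  On a Hilbert space every positive operator has exactly one positive square root, so the
  description below is proper for the covariance operators to which it is applied.
\<close>

definition operator_sqrt :: "('h::real_inner \<Rightarrow> 'h) \<Rightarrow> ('h \<Rightarrow> 'h)" where
  "operator_sqrt T = (THE S. positive_operator S \<and> S \<circ> S = T)"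

definition zero_inner_point :: "'h::real_vector set \<Rightarrow> bool" where
  "zero_inner_point U \<longleftrightarrow> (\<forall>y. \<exists>c>0. c *\<^sub>R y \<in> U \<and> - (c *\<^sub>R y) \<in> U)"

subsection \<open>Gaussian random vectors in a Hilbert space\<close>

text \<open>Normal laws, including the degenerate ones.\<close>

definition gaussian_variable :: "'w measure \<Rightarrow> ('w \<Rightarrow> real) \<Rightarrow> bool" where
  "gaussian_variable M X \<longleftrightarrow> X \<in> borel_measurable M \<and>
     ((\<exists>m s. 0 < s \<and> distributed M lborel X (normal_density m s)) \<or>
      (\<exists>m. AE w in M. X w = m))"

text \<open>
  A Gaussian random vector whose covariance operator need not be of trace class (for instance
  white noise, with the identity as covariance) takes no values in the space itself.  It is
  given by its coordinates: \<open>\<xi> h\<close> is the real random variable that stands for the inner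
  product of the vector with \<open>h\<close>, and it is almost surely linear in \<open>h\<close>.  A Gaussian vector
  \<open>X\<close> with values in the space is the case \<open>\<xi> h w = X w \<bullet> h\<close>.  Joint normality of the
  coordinates is normality of each of them, by linearity.
\<close>

definition gaussian_vector :: "'w measure \<Rightarrow> ('h::real_inner \<Rightarrow> 'w \<Rightarrow> real) \<Rightarrow> bool" where
  "gaussian_vector M \<xi> \<longleftrightarrow>
     (\<forall>h. gaussian_variable M (\<xi> h)) \<and>
     (\<forall>a b g h. AE w in M. \<xi> (a *\<^sub>R g + b *\<^sub>R h) w = a * \<xi> g w + b * \<xi> h w)"

definition mean_zero :: "'w measure \<Rightarrow> ('h::real_inner \<Rightarrow> 'w \<Rightarrow> real) \<Rightarrow> bool" where
  "mean_zero M \<xi> \<longleftrightarrow> (\<forall>h. (\<integral>w. \<xi> h w \<partial>M) = 0)"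

definition covariance_operator ::
    "'w measure \<Rightarrow> ('h::real_inner \<Rightarrow> 'w \<Rightarrow> real) \<Rightarrow> ('h \<Rightarrow> 'h) \<Rightarrow> bool" where
  "covariance_operator M \<xi> R \<longleftrightarrow> bounded_linear R \<and>
     (\<forall>g h. R g \<bullet> h =
        (\<integral>w. (\<xi> g w - (\<integral>v. \<xi> g v \<partial>M)) * (\<xi> h w - (\<integral>v. \<xi> h v \<partial>M)) \<partial>M))"

subsection \<open>Observations and tests\<close>

text \<open>
  The random vector \<open>A \<theta> + e \<xi>\<close>, given by its coordinates in the same sense.  The sample space
  is that of all real functions on the Hilbert space, with the sigma-algebra generated by the
  coordinates; on a separable space, viewed inside it through \<open>y \<mapsto> (\<lambda>h. y \<bullet> h)\<close>, this
  sigma-algebra induces the Borel one.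
\<close>

definition observation ::
    "('h::real_inner \<Rightarrow> 'h) \<Rightarrow> ('h \<Rightarrow> 'w \<Rightarrow> real) \<Rightarrow> real \<Rightarrow> 'h \<Rightarrow> 'w \<Rightarrow> ('h \<Rightarrow> real)" where
  "observation A \<xi> e \<theta> w = (\<lambda>h. A \<theta> \<bullet> h + e * \<xi> h w)"

definition is_test :: "(('h \<Rightarrow> real) \<Rightarrow> real) \<Rightarrow> bool" where
  "is_test K \<longleftrightarrow> K \<in> borel_measurable (PiM UNIV (\<lambda>h::'h. (borel :: real measure))) \<and>
     (\<forall>y. 0 \<le> K y \<and> K y \<le> 1)"

definition type_I_error ::
    "'w measure \<Rightarrow> ('h::zero \<Rightarrow> 'w \<Rightarrow> 'y) \<Rightarrow> ('y \<Rightarrow> real) \<Rightarrow> real" where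
  "type_I_error M Y K = (\<integral>w. K (Y 0 w) \<partial>M)"

definition type_II_error ::
    "'w measure \<Rightarrow> ('h \<Rightarrow> 'w \<Rightarrow> 'y) \<Rightarrow> ('y \<Rightarrow> real) \<Rightarrow> 'h \<Rightarrow> real" where
  "type_II_error M Y K \<theta> = (\<integral>w. 1 - K (Y \<theta> w) \<partial>M)"

text \<open>
  The supremum is taken in the extended reals, so that it is meaningful for empty
  alternatives as well.
\<close>

definition type_II_error_sup ::
    "'w measure \<Rightarrow> ('h \<Rightarrow> 'w \<Rightarrow> 'y) \<Rightarrow> ('y \<Rightarrow> real) \<Rightarrow> 'h set \<Rightarrow> ereal" where
  "type_II_error_sup M Y K V = (SUP \<theta>\<in>V. ereal (type_II_error M Y K \<theta>))"

definition uniformly_consistent ::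
    "'w measure \<Rightarrow> (nat \<Rightarrow> 'h::zero \<Rightarrow> 'w \<Rightarrow> ('h \<Rightarrow> real)) \<Rightarrow> real \<Rightarrow>
     (nat \<Rightarrow> ('h \<Rightarrow> real) \<Rightarrow> real) \<Rightarrow> (nat \<Rightarrow> 'h set) \<Rightarrow> bool" where
  "uniformly_consistent M Y \<alpha> K V \<longleftrightarrow>
     (\<forall>n. is_test (K n)) \<and>
     (\<lambda>n. type_I_error M (Y n) (K n)) \<longlonglongrightarrow> \<alpha> \<and>
     limsup (\<lambda>n. type_II_error_sup M (Y n) (K n) (V n)) < ereal (1 - \<alpha>)"

end

theory Submission
  imports Defs
begin

text \<open>
  Write \<open>S\<close> for the square root of the covariance operator and \<open>A = S \<circ> B\<close> with \<open>B\<close> bounded.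

  If \<open>closure U\<close> is compact, its points of norm at least \<open>r > 0\<close> form a compact set on which \<open>A\<close>
  does not vanish, so finitely many coordinates of the observation separate all of them
  from \<open>0\<close> by a fixed amount (\<open>separating_functionals\<close>).  Rejecting when one of these coordinates
  is large has both errors of order \<open>\<epsilon> n\<close> by Markov's inequality (\<open>rejects_errors\<close>), with a constant
  that depends on \<open>r\<close>; letting \<open>r\<close> tend to \<open>0\<close> slowly along a diagonal keeps the errors small.

  Suppose that \<open>closure U\<close> is not compact.  By Baire's theorem it contains a ball around \<open>0\<close>, and
  since \<open>U\<close> is not totally bounded, \<open>U\<close> has points of norm at least a fixed \<open>r > 0\<close> on which any given
  finite set of functionals is almost zero (\<open>almost_annihilated_points\<close>).  Hence for every \<open>k\<close> there are
  alternatives \<open>\<theta> i\<close>, \<open>i < k\<close>, of norm at least \<open>r\<close> whose images \<open>v i = B (\<theta> i) / \<epsilon> n\<close> are bounded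
  and nearly orthogonal.  The likelihood ratio at \<open>\<theta> i\<close> is \<open>exp (W (v i) - (norm (v i))\<^sup>2 / 2)\<close>,
  where \<open>W\<close> is the isonormal field that extends \<open>S h \<mapsto> \<xi> h\<close> (\<open>cameron_martin\<close>), and two of them have
  covariance \<open>exp (v i \<bullet> v j) - 1\<close>.  So the mean of the \<open>k\<close> likelihood ratios has variance close to
  \<open>0\<close> for large \<open>k\<close>, and no test distinguishes the hypothesis from the uniform mixture of these
  alternatives (\<open>mixture_of_shifts\<close>).  For one large \<open>n\<close> with \<open>\<rho> n < r\<close> this contradicts uniform
  consistency.

  Two tools carry this.  A positive operator has a unique positive square root, which is the one
  that \<open>operator_sqrt\<close> describes.  A probability measure on a space of real
  functions is determined by the integrals of cosines of linear forms in finitely many coordinates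
  (\<open>product_measure_eqI_cos\<close>), which identifies the likelihood ratio from normality of the single
  coordinates.
\<close>

section \<open>Positive operators and their square roots\<close>

lemma positive_operatorD:
  assumes "positive_operator T"
  shows "bounded_linear T" "T x \<bullet> y = x \<bullet> T y" "0 \<le> T x \<bullet> x"
  using assms by (auto simp: positive_operator_def)

text \<open>
  For \<open>0 \<le> T \<le> 1\<close> the difference \<open>T - T\<^sup>2\<close> is the sum \<open>(1 - T) T (1 - T) + T (1 - T) T\<close> of positive
  operators.
\<close>

lemma positive_operator_contraction:
  assumes T: "positive_operator T" and le: "\<And>x. T x \<bullet> x \<le> x \<bullet> x"
  shows "T x \<bullet> T x \<le> T x \<bullet> x"
proof -
  interpret bounded_linear T using T by (rule positive_operatorD)
  have "T x \<bullet> x - T x \<bullet> T x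
      = T (x - T x) \<bullet> (x - T x) + (T x \<bullet> T x - T (T x) \<bullet> T x)"
    using positive_operatorD(2)[OF T, of "T x" x]
    by (simp add: diff inner_diff_left inner_diff_right inner_commute)
  also have "\<dots> \<ge> 0"
    using positive_operatorD(3)[OF T, of "x - T x"] le[of "T x"] by simp
  finally show ?thesis by simp
qed

lemma positive_operator_scaleR:
  assumes "positive_operator T" "0 \<le> c"
  shows "positive_operator (\<lambda>x. c *\<^sub>R T x)"
  using assms by (auto simp: positive_operator_def intro: bounded_linear_const_scaleR)

lemma positive_operator_normalisation:
  assumes T: "positive_operator T"
  obtains K where "0 < K" "\<And>x. ((1/K) *\<^sub>R T x) \<bullet> x \<le> x \<bullet> x"
proof -
  obtain K where K: "0 < K" "\<And>x. norm (T x) \<le> norm x * K"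
    using bounded_linear.pos_bounded[OF positive_operatorD(1)[OF T]] by blast
  have "((1/K) *\<^sub>R T x) \<bullet> x \<le> x \<bullet> x" for x
  proof -
    have "T x \<bullet> x \<le> norm (T x) * norm x" by (rule norm_cauchy_schwarz)
    also have "\<dots> \<le> (norm x * K) * norm x" by (intro mult_right_mono K) simp
    also have "\<dots> = K * (x \<bullet> x)" by (simp add: power2_norm_eq_inner[symmetric] power2_eq_square)
    finally show ?thesis using K(1) by (simp add: field_simps)
  qed
  with K(1) show thesis by (rule that)
qed

text \<open>
  After normalisation to \<open>T \<le> 1\<close> the norm of \<open>T x\<close> is controlled by the quadratic form.
\<close>

lemma positive_operator_kernel:
  assumes T: "positive_operator T" and z: "T x \<bullet> x = 0"
  shows "T x = 0"
proof -
  obtain K where K: "0 < K" "\<And>x. ((1/K) *\<^sub>R T x) \<bullet> x \<le> x \<bullet> x"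
    using positive_operator_normalisation[OF T] by blast
  have "positive_operator (\<lambda>x. (1/K) *\<^sub>R T x)"
    using T K(1) by (intro positive_operator_scaleR) auto
  from positive_operator_contraction[OF this K(2), of x] z K(1) have "T x \<bullet> T x \<le> 0"
    by (simp add: divide_le_0_iff mult_le_0_iff)
  then show ?thesis by (metis inner_eq_zero_iff inner_ge_zero order_antisym)
qed

text \<open>
  With \<open>T = 1 - C\<close>, the equation \<open>(1 - B)\<^sup>2 = T\<close> reads \<open>B = (C + B\<^sup>2) / 2\<close> and is solved by
  iteration from \<open>0\<close>.  The same iteration for the number \<open>1\<close> in place of \<open>C\<close> majorises it.
\<close>

primrec sqrt_iter :: "('h \<Rightarrow> 'h) \<Rightarrow> nat \<Rightarrow> 'h \<Rightarrow> 'h::real_vector" where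
  "sqrt_iter C 0 = (\<lambda>x. 0)"
| "sqrt_iter C (Suc n) = (\<lambda>x. (1/2) *\<^sub>R (C x + sqrt_iter C n (sqrt_iter C n x)))"

primrec sqrt_majorant :: "nat \<Rightarrow> real" where
  "sqrt_majorant 0 = 0"
| "sqrt_majorant (Suc n) = (1 + (sqrt_majorant n)\<^sup>2) / 2"

lemma sqrt_majorant_bounds: "0 \<le> sqrt_majorant n" "sqrt_majorant n \<le> 1"
proof -
  have "0 \<le> sqrt_majorant n \<and> sqrt_majorant n \<le> 1"
  proof (induction n)
    case (Suc n)
    then have "(sqrt_majorant n)\<^sup>2 \<le> 1" by (simp add: power_le_one)
    then show ?case by simp
  qed simp
  then show "0 \<le> sqrt_majorant n" "sqrt_majorant n \<le> 1" by auto
qed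

lemma sqrt_majorant_Suc: "sqrt_majorant n \<le> sqrt_majorant (Suc n)"
  using zero_le_power2[of "sqrt_majorant n - 1"] by (simp add: power2_eq_square algebra_simps)

lemma sqrt_iter_bounded_linear:
  assumes "bounded_linear C" shows "bounded_linear (sqrt_iter C n)"
proof (induction n)
  case 0
  show ?case by (simp add: bounded_linear_zero)
next
  case (Suc n)
  from bounded_linear_compose[OF Suc Suc] bounded_linear_const_scaleR[OF bounded_linear_add[OF assms]]
  show ?case by simp
qed

lemma sqrt_iter_norm:
  assumes C: "\<And>x. norm (C x) \<le> norm x"
  shows "norm (sqrt_iter C n x) \<le> sqrt_majorant n * norm (x::'h::real_normed_vector)"
proof (induction n arbitrary: x)
  case (Suc n)
  let ?B = "sqrt_iter C n" and ?b = "sqrt_majorant n"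
  have "norm (C x + ?B (?B x)) \<le> norm (C x) + norm (?B (?B x))" by (rule norm_triangle_ineq)
  also have "norm (?B (?B x)) \<le> ?b * (?b * norm x)"
    using Suc[of "?B x"] mult_left_mono[OF Suc[of x], of ?b] sqrt_majorant_bounds[of n] by simp
  finally have "norm (C x + ?B (?B x)) \<le> (1 + ?b\<^sup>2) * norm x"
    using C[of x] by (simp add: power2_eq_square algebra_simps)
  then show ?case by simp
qed simp

text \<open>
  By the identity \<open>B'\<^sup>2 - B\<^sup>2 = B' (B' - B) + (B' - B) B\<close> for consecutive iterates, the bound on
  one step follows from the bound on the preceding one exactly as for the scalar majorant.
\<close>

lemma sqrt_iter_step:
  fixes x :: "'h::real_normed_vector"
  assumes lin: "bounded_linear C" and C: "\<And>x. norm (C x) \<le> norm x"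
  shows "norm (sqrt_iter C (Suc n) x - sqrt_iter C n x)
           \<le> (sqrt_majorant (Suc n) - sqrt_majorant n) * norm x"
proof (induction n arbitrary: x)
  case 0
  show ?case using C[of x] by simp
next
  case (Suc n)
  define B B' b b' where defs: "B = sqrt_iter C n" "B' = sqrt_iter C (Suc n)"
    "b = sqrt_majorant n" "b' = sqrt_majorant (Suc n)"
  interpret B': bounded_linear B' unfolding defs by (rule sqrt_iter_bounded_linear[OF lin])
  have nonneg: "0 \<le> b" "0 \<le> b'" unfolding defs by (rule sqrt_majorant_bounds)+
  have IH: "norm (B' y - B y) \<le> (b' - b) * norm y" for y
    unfolding defs by (rule Suc)
  have nB: "norm (B y) \<le> b * norm y" "norm (B' y) \<le> b' * norm y" for y
    unfolding defs by (rule sqrt_iter_norm[OF C])+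
  have "norm (B' (B' x) - B (B x)) = norm (B' (B' x - B x) + (B' (B x) - B (B x)))"
    by (simp add: B'.diff)
  also have "\<dots> \<le> norm (B' (B' x - B x)) + norm (B' (B x) - B (B x))"
    by (rule norm_triangle_ineq)
  also have "norm (B' (B' x - B x)) \<le> b' * ((b' - b) * norm x)"
    using nB(2)[of "B' x - B x"] mult_left_mono[OF IH[of x] nonneg(2)] by linarith
  also have "norm (B' (B x) - B (B x)) \<le> (b' - b) * (b * norm x)"
  proof -
    have "0 \<le> b' - b" unfolding defs using sqrt_majorant_Suc[of n] by simp
    from mult_left_mono[OF nB(1)[of x] this] IH[of "B x"] show ?thesis by linarith
  qed
  finally have *: "norm (B' (B' x) - B (B x)) \<le> (b'\<^sup>2 - b\<^sup>2) * norm x"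
    by (simp add: algebra_simps power2_eq_square)
  have eq: "sqrt_iter C (Suc (Suc n)) x - sqrt_iter C (Suc n) x = (1/2) *\<^sub>R (B' (B' x) - B (B x))"
    unfolding defs sqrt_iter.simps(2)[of C "Suc n"]
    by (simp add: scaleR_diff_right[symmetric] scaleR_add_right[symmetric] del: scaleR_add_right)
  have "norm (sqrt_iter C (Suc (Suc n)) x - sqrt_iter C (Suc n) x) \<le> ((b'\<^sup>2 - b\<^sup>2) / 2) * norm x"
    unfolding eq using * by simp
  also have "(b'\<^sup>2 - b\<^sup>2) / 2 = sqrt_majorant (Suc (Suc n)) - sqrt_majorant (Suc n)"
    unfolding defs sqrt_majorant.simps(2)[of "Suc n"] by (simp add: field_simps)
  finally show ?case .
qed

lemma sqrt_iter_diff: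
  fixes x :: "'h::real_normed_vector"
  assumes lin: "bounded_linear C" and C: "\<And>x. norm (C x) \<le> norm x" and "m \<le> n"
  shows "norm (sqrt_iter C n x - sqrt_iter C m x) \<le> (sqrt_majorant n - sqrt_majorant m) * norm x"
  using \<open>m \<le> n\<close>
proof (induction n rule: dec_induct)
  case (step n)
  have "norm (sqrt_iter C (Suc n) x - sqrt_iter C m x)
      \<le> norm (sqrt_iter C (Suc n) x - sqrt_iter C n x) + norm (sqrt_iter C n x - sqrt_iter C m x)"
    using norm_triangle_ineq[of "sqrt_iter C (Suc n) x - sqrt_iter C n x" "sqrt_iter C n x - sqrt_iter C m x"]
    by simp
  with step.IH sqrt_iter_step[OF lin C, of n x] show ?case by (simp only: left_diff_distrib)
qed simp

lemma sqrt_iter_convergent: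
  fixes x :: "'h::{real_normed_vector, complete_space}"
  assumes lin: "bounded_linear C" and C: "\<And>x. norm (C x) \<le> norm x"
  shows "convergent (\<lambda>n. sqrt_iter C n x)"
proof -
  have "incseq sqrt_majorant" by (simp add: incseq_Suc_iff sqrt_majorant_Suc del: sqrt_majorant.simps)
  then have "convergent sqrt_majorant"
    by (rule incseq_convergent[of sqrt_majorant 1]) (auto simp: convergent_def sqrt_majorant_bounds)
  then have "Cauchy sqrt_majorant" by (rule convergent_Cauchy)
  then have "Cauchy (\<lambda>n. sqrt_majorant n * norm x)"
    by (intro Cauchy_convergent_iff[THEN iffD2] convergent_mult convergent_const) (simp add: Cauchy_convergent_iff)
  have "Cauchy (\<lambda>n. sqrt_iter C n x)"
  proof (rule CauchyI)
    fix e :: real assume "0 < e"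
    with CauchyD[OF \<open>Cauchy (\<lambda>n. sqrt_majorant n * norm x)\<close>] obtain M where
      M: "\<And>m n. M \<le> m \<Longrightarrow> M \<le> n \<Longrightarrow> norm (sqrt_majorant m * norm x - sqrt_majorant n * norm x) < e"
      by blast
    have "norm (sqrt_iter C m x - sqrt_iter C n x) < e" if "M \<le> m" "M \<le> n" for m n
    proof (cases "n \<le> m")
      case True
      then show ?thesis
        using sqrt_iter_diff[OF lin C True, of x] M[OF that] by (simp add: left_diff_distrib)
    next
      case False
      then show ?thesis
        using sqrt_iter_diff[OF lin C, of m n x] M[OF that] by (simp add: left_diff_distrib norm_minus_commute)
    qed
    then show "\<exists>M. \<forall>m\<ge>M. \<forall>n\<ge>M. norm (sqrt_iter C m x - sqrt_iter C n x) < e" by blast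
  qed
  then show ?thesis by (simp add: Cauchy_convergent_iff)
qed

text \<open>
  The majorant is increasing and bounded by \<open>1\<close>, so the iterates form a Cauchy sequence at every
  vector.  Each iterate is a polynomial in \<open>C\<close>; hence the limit commutes with everything that
  commutes with \<open>C\<close>.
\<close>

lemma sqrt_iter_limit:
  fixes C :: "'h::{real_inner, complete_space} \<Rightarrow> 'h"
  assumes lin: "bounded_linear C" and C: "\<And>x. norm (C x) \<le> norm x"
    and sa: "\<And>x y. C x \<bullet> y = x \<bullet> C y"
  obtains B where "bounded_linear B" "\<And>x y. B x \<bullet> y = x \<bullet> B y" "\<And>x. norm (B x) \<le> norm x"
    "\<And>x. B x = (1/2) *\<^sub>R (C x + B (B x))"
    "\<And>D x. bounded_linear D \<Longrightarrow> (\<And>x. D (C x) = C (D x)) \<Longrightarrow> D (B x) = B (D x)"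
proof -
  let ?B = "sqrt_iter C"
  define B where "B x = lim (\<lambda>n. ?B n x)" for x
  have lim: "(\<lambda>n. ?B n x) \<longlonglongrightarrow> B x" for x
    using sqrt_iter_convergent[OF lin C, of x] unfolding B_def convergent_LIMSEQ_iff .
  interpret Bn: bounded_linear "?B n" for n by (rule sqrt_iter_bounded_linear[OF lin])
  have contr: "norm (?B n x) \<le> norm x" for n x
    using sqrt_iter_norm[OF C, of n x] mult_right_mono[OF sqrt_majorant_bounds(2), of "norm x" n]
    by simp
  have nB: "norm (B x) \<le> norm x" for x
    by (rule LIMSEQ_le_const2[OF tendsto_norm[OF lim[of x]]]) (use contr in blast)
  have bl: "bounded_linear B"
  proof (rule bounded_linear_intro[where K = 1])
    fix x y
    show "B (x + y) = B x + B y"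
      using LIMSEQ_unique[OF lim[of "x + y"]] tendsto_add[OF lim[of x] lim[of y]] by (simp add: Bn.add)
  next
    fix r x
    show "B (r *\<^sub>R x) = r *\<^sub>R B x"
      using LIMSEQ_unique[OF lim[of "r *\<^sub>R x"]] tendsto_scaleR[OF tendsto_const lim[of x], of r]
      by (simp add: Bn.scaleR)
  qed (use nB in simp)
  have san: "?B n x \<bullet> y = x \<bullet> ?B n y" for n x y
    by (induction n arbitrary: x y) (auto simp: inner_add_left inner_add_right sa)
  have sB: "B x \<bullet> y = x \<bullet> B y" for x y
    using LIMSEQ_unique[OF tendsto_inner[OF lim[of x] tendsto_const[of y]]]
      tendsto_inner[OF tendsto_const[of x] lim[of y]] by (simp add: san)
  have lim2: "(\<lambda>n. ?B n (?B n x)) \<longlonglongrightarrow> B (B x)" for x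
  proof -
    have "(\<lambda>n. ?B n (?B n x - B x)) \<longlonglongrightarrow> 0"
      by (rule tendsto_0_le[where K = 1 and f = "\<lambda>n. ?B n x - B x"])
         (use lim[of x] contr in \<open>auto simp: LIM_zero\<close>)
    from tendsto_add[OF this lim[of "B x"]] show ?thesis by (simp add: Bn.diff)
  qed
  have fix_eq: "B x = (1/2) *\<^sub>R (C x + B (B x))" for x
  proof -
    have "(\<lambda>n. ?B (Suc n) x) \<longlonglongrightarrow> (1/2) *\<^sub>R (C x + B (B x))"
      unfolding sqrt_iter.simps by (intro tendsto_intros lim2)
    with LIMSEQ_Suc[OF lim[of x]] show ?thesis by (rule LIMSEQ_unique)
  qed
  have comm: "D (B x) = B (D x)" if D: "bounded_linear D" and DC: "\<And>x. D (C x) = C (D x)" for D x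
  proof -
    interpret D: bounded_linear D by fact
    have "D (?B n x) = ?B n (D x)" for n x
      by (induction n arbitrary: x) (auto simp: D.zero D.scaleR D.add DC)
    with D.tendsto[OF lim[of x]] lim[of "D x"] show ?thesis by (simp add: LIMSEQ_unique)
  qed
  show thesis by (rule that[OF bl sB nB fix_eq comm])
qed

lemma positive_sqrt_exists:
  fixes T :: "'h::{real_inner, complete_space} \<Rightarrow> 'h"
  assumes T: "positive_operator T"
  obtains S where "positive_operator S" "S \<circ> S = T"
    "\<And>D x. bounded_linear D \<Longrightarrow> (\<And>x. D (T x) = T (D x)) \<Longrightarrow> D (S x) = S (D x)"
proof -
  obtain K where K: "0 < K" "\<And>x. ((1/K) *\<^sub>R T x) \<bullet> x \<le> x \<bullet> x"
    using positive_operator_normalisation[OF T] by blast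
  interpret T: bounded_linear T by (rule positive_operatorD(1)[OF T])
  define C where "C x = x - (1/K) *\<^sub>R T x" for x
  have posC: "positive_operator C"
    unfolding positive_operator_def
  proof (intro conjI allI)
    show "bounded_linear C"
      unfolding C_def
      by (intro bounded_linear_sub bounded_linear_const_scaleR bounded_linear_ident T.bounded_linear_axioms)
    show "C x \<bullet> y = x \<bullet> C y" for x y
      using positive_operatorD(2)[OF T, of x y] by (simp add: C_def inner_diff_left inner_diff_right)
    show "0 \<le> C x \<bullet> x" for x
      using K(2)[of x] by (simp add: C_def inner_diff_left)
  qed
  have "C x \<bullet> x \<le> x \<bullet> x" for x
    using positive_operatorD(3)[OF T, of x] K(1) by (simp add: C_def inner_diff_left)
  then have "C x \<bullet> C x \<le> x \<bullet> x" for x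
    using positive_operator_contraction[OF posC, of x] by (meson order_trans)
  then have nC: "norm (C x) \<le> norm x" for x by (simp add: norm_le)
  obtain B where B: "bounded_linear B" "\<And>x y. B x \<bullet> y = x \<bullet> B y" "\<And>x. norm (B x) \<le> norm x"
    "\<And>x. B x = (1/2) *\<^sub>R (C x + B (B x))"
    "\<And>D x. bounded_linear D \<Longrightarrow> (\<And>x. D (C x) = C (D x)) \<Longrightarrow> D (B x) = B (D x)"
    using sqrt_iter_limit[OF positive_operatorD(1)[OF posC] nC positive_operatorD(2)[OF posC]] by blast
  interpret B: bounded_linear B by fact
  define S where "S x = sqrt K *\<^sub>R (x - B x)" for x
  have "positive_operator S"
    unfolding positive_operator_def
  proof (intro conjI allI)
    show "bounded_linear S"
      unfolding S_def by (intro bounded_linear_sub bounded_linear_const_scaleR bounded_linear_ident B(1))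
    show "S x \<bullet> y = x \<bullet> S y" for x y
      using B(2)[of x y] by (simp add: S_def inner_diff_left inner_diff_right)
    have "B x \<bullet> x \<le> x \<bullet> x" for x
      using norm_cauchy_schwarz[of "B x" x] mult_right_mono[OF B(3)[of x], of "norm x"]
      by (simp add: power2_norm_eq_inner[symmetric] power2_eq_square)
    then show "0 \<le> S x \<bullet> x" for x
      using K(1) by (simp add: S_def inner_diff_left)
  qed
  moreover have "S \<circ> S = T"
  proof (rule ext)
    fix x
    have BB: "B (B x) = 2 *\<^sub>R B x - C x"
      using arg_cong[OF B(4)[of x], of "\<lambda>y. 2 *\<^sub>R y"] by (simp add: algebra_simps)
    have "S (S x) = (sqrt K * sqrt K) *\<^sub>R (x - B x - B x + B (B x))"
      by (simp add: S_def B.diff B.scaleR algebra_simps)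
    also have "\<dots> = K *\<^sub>R (x - C x)"
      using K(1) BB by (simp add: scaleR_2)
    also have "\<dots> = T x" using K(1) by (simp add: C_def)
    finally show "(S \<circ> S) x = T x" by simp
  qed
  moreover have "D (S x) = S (D x)"
    if D: "bounded_linear D" and DT: "\<And>x. D (T x) = T (D x)" for D x
  proof -
    interpret D: bounded_linear D by fact
    have "D (C x) = C (D x)" for x by (simp add: C_def D.diff D.scaleR DT)
    from B(5)[OF D this] show ?thesis by (simp add: S_def D.diff D.scaleR)
  qed
  ultimately show thesis by (rule that)
qed

text \<open>
  The root built above commutes with everything that commutes with \<open>T\<close>, in particular with any
  other root \<open>Q\<close>.  Hence \<open>(S + Q) (S - Q) = 0\<close>, and positivity makes both roots vanish on the
  range of \<open>S - Q\<close>.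
\<close>

lemma operator_sqrt:
  fixes T :: "'h::{real_inner, complete_space} \<Rightarrow> 'h"
  assumes T: "positive_operator T"
  shows "positive_operator (operator_sqrt T)" "operator_sqrt T (operator_sqrt T x) = T x"
proof -
  obtain S where S: "positive_operator S" "S \<circ> S = T"
    and comm: "\<And>D x. bounded_linear D \<Longrightarrow> (\<And>x. D (T x) = T (D x)) \<Longrightarrow> D (S x) = S (D x)"
    using positive_sqrt_exists[OF T] by blast
  have uniq: "Q = S" if Q: "positive_operator Q" "Q \<circ> Q = T" for Q
  proof (rule ext)
    fix x
    interpret S: bounded_linear S by (rule positive_operatorD(1)[OF S(1)])
    interpret Q: bounded_linear Q by (rule positive_operatorD(1)[OF Q(1)])
    have SS: "S (S y) = T y" and QQ: "Q (Q y) = T y" for y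
      using S(2) Q(2) by (auto simp: fun_eq_iff)
    have QS: "Q (S y) = S (Q y)" for y
      by (rule comm[OF Q.bounded_linear_axioms]) (simp add: QQ[symmetric])
    define y where "y = S x - Q x"
    have "S y + Q y = 0" by (simp add: y_def S.diff Q.diff SS QQ QS)
    then have "S y \<bullet> y + Q y \<bullet> y = 0" using inner_add_left[of "S y" "Q y" y] by simp
    then have "S y \<bullet> y = 0" "Q y \<bullet> y = 0"
      using positive_operatorD(3)[OF S(1), of y] positive_operatorD(3)[OF Q(1), of y] by auto
    then have "S y = 0" "Q y = 0"
      using positive_operator_kernel S(1) Q(1) by blast+
    then have "y \<bullet> y = 0"
      using positive_operatorD(2)[OF S(1), of x y] positive_operatorD(2)[OF Q(1), of x y]
      by (subst (1) y_def) (simp add: inner_diff_left)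
    then show "Q x = S x" by (simp add: y_def)
  qed
  have "operator_sqrt T = S"
    unfolding operator_sqrt_def using S uniq by blast
  then show "positive_operator (operator_sqrt T)" "operator_sqrt T (operator_sqrt T x) = T x"
    using S(1) S(2)[THEN fun_cong, of x] by simp_all
qed

section \<open>Geometry of the Hilbert space\<close>

text \<open>
  The distance \<open>d\<close> of \<open>v\<close> from the range is attained in the limit by residuals \<open>v - S h\<close>,
  which form a Cauchy sequence by the parallelogram identity.  Their limit \<open>r\<close> cannot be shortened
  in the direction \<open>S (S r)\<close>, which forces \<open>S r = 0\<close>.
\<close>

lemma dense_range_of_injective_selfadjoint:
  fixes S :: "'h::{real_inner, complete_space} \<Rightarrow> 'h"
  assumes lin: "bounded_linear S" and sa: "\<And>x y. S x \<bullet> y = x \<bullet> S y"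
    and ker: "\<And>x. S x = 0 \<Longrightarrow> x = 0"
  shows "closure (range S) = UNIV"
proof -
  interpret S: bounded_linear S by fact
  have "v \<in> closure (range S)" for v
  proof -
    define d where "d = infdist v (range S)"
    have "0 \<le> d" unfolding d_def by (rule infdist_nonneg)
    have d_le: "d \<le> norm (v - S h)" for h
      unfolding d_def dist_norm[symmetric] by (rule infdist_le) simp
    have "\<exists>h. norm (v - S h) < d + inverse (real (Suc n))" for n
    proof (rule ccontr)
      assume "\<not> ?thesis"
      then have "d + inverse (real (Suc n)) \<le> infdist v (range S)"
        by (auto simp: infdist_def dist_norm not_less intro!: cINF_greatest)
      then show False unfolding d_def by simp
    qed
    then obtain h where h: "\<And>n. norm (v - S (h n)) < d + inverse (real (Suc n))" by metis
    define q where "q n = v - S (h n)" for n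
    have lim_norm: "(\<lambda>n. norm (q n)) \<longlonglongrightarrow> d"
    proof (rule tendsto_sandwich[OF _ _ tendsto_const])
      show "(\<lambda>n. d + inverse (real (Suc n))) \<longlonglongrightarrow> d"
        using tendsto_add[OF tendsto_const[of d] LIMSEQ_inverse_real_of_nat] by simp
    qed (use d_le h in \<open>auto simp: q_def simp del: of_nat_Suc intro!: always_eventually less_imp_le\<close>)
    have "Cauchy q"
    proof (rule CauchyI)
      fix e :: real assume "0 < e"
      have "(\<lambda>n. (norm (q n))\<^sup>2) \<longlonglongrightarrow> d\<^sup>2" by (intro tendsto_intros lim_norm)
      from order_tendstoD(2)[OF this, of "d\<^sup>2 + e\<^sup>2 / 4"] obtain N where
        N: "\<And>n. N \<le> n \<Longrightarrow> (norm (q n))\<^sup>2 < d\<^sup>2 + e\<^sup>2 / 4"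
        using \<open>0 < e\<close> by (auto simp: eventually_sequentially)
      have "norm (q m - q n) < e" if "N \<le> m" "N \<le> n" for m n
      proof -
        have "q m + q n = 2 *\<^sub>R (v - S ((1/2) *\<^sub>R (h m + h n)))"
          by (simp add: q_def S.add S.scaleR algebra_simps scaleR_2)
        then have "2 * d \<le> norm (q m + q n)" using d_le[of "(1/2) *\<^sub>R (h m + h n)"] by simp
        then have "(2 * d)\<^sup>2 \<le> (norm (q m + q n))\<^sup>2" using \<open>0 \<le> d\<close> by (intro power_mono) auto
        moreover have "(norm (q m - q n))\<^sup>2 + (norm (q m + q n))\<^sup>2
            = 2 * (norm (q m))\<^sup>2 + 2 * (norm (q n))\<^sup>2"
          by (simp add: power2_norm_eq_inner inner_simps inner_commute)
        ultimately have "(norm (q m - q n))\<^sup>2 < e\<^sup>2"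
          using N[OF that(1)] N[OF that(2)] by (simp add: power_mult_distrib)
        then show ?thesis using \<open>0 < e\<close> by (auto dest: power_less_imp_less_base)
      qed
      then show "\<exists>M. \<forall>m\<ge>M. \<forall>n\<ge>M. norm (q m - q n) < e" by blast
    qed
    then obtain r where r: "q \<longlonglongrightarrow> r" by (auto simp: Cauchy_convergent_iff convergent_def)
    have norm_r: "norm r = d"
      using LIMSEQ_unique[OF tendsto_norm[OF r] lim_norm] .
    have min: "norm r \<le> norm (r - S g)" for g
      unfolding norm_r
    proof (rule LIMSEQ_le_const)
      show "(\<lambda>n. norm (q n - S g)) \<longlonglongrightarrow> norm (r - S g)" by (intro tendsto_intros r)
      show "\<exists>N. \<forall>n\<ge>N. d \<le> norm (q n - S g)"
        using d_le[of "h _ + g"] by (auto simp: q_def S.add algebra_simps)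
    qed
    have "S r \<bullet> S r = 0"
    proof (rule ccontr)
      assume "S r \<bullet> S r \<noteq> 0"
      then have a: "0 < S r \<bullet> S r" (is "0 < ?a") by simp
      let ?b = "S (S r) \<bullet> S (S r)"
      have b: "0 \<le> ?b" by simp
      define t where "t = ?a / (?b + 1)"
      have "0 < ?b + 1" using b by linarith
      then have "0 < t" using a unfolding t_def by (intro divide_pos_pos)
      moreover have "t * (?b + 1) = ?a" using \<open>0 < ?b + 1\<close> by (simp add: t_def)
      ultimately have t: "0 < t" "t * ?b < ?a" by (simp_all add: algebra_simps)
      have "(norm r)\<^sup>2 \<le> (norm (r - S (t *\<^sub>R S r)))\<^sup>2" using min by (intro power_mono) auto
      also have "\<dots> = (norm r)\<^sup>2 - 2 * t * ?a + t * (t * ?b)"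
        using sa[of r "S r"]
        by (simp add: power2_norm_eq_inner inner_simps S.scaleR inner_commute algebra_simps)
      also have "\<dots> < (norm r)\<^sup>2"
        using mult_strict_left_mono[OF t(2) t(1)] mult_pos_pos[OF t(1) a] by linarith
      finally show False by simp
    qed
    then have "r = 0" using ker by simp
    with norm_r have "infdist v (range S) = 0" by (simp add: d_def)
    then show ?thesis by (simp add: in_closure_iff_infdist_zero)
  qed
  then show ?thesis by blast
qed

text \<open>
  The dilations of \<open>closure U\<close> cover the space, so by the Baire category theorem \<open>closure U\<close>
  contains a ball around some \<open>x\<close>.  A convex combination with a point \<open>- c x\<close> of \<open>U\<close> moves that
  ball to the origin.
\<close>

lemma ball_subset_closure_of_absorbing_convex:
  fixes U :: "'h::{real_normed_vector, complete_space} set"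
  assumes conv: "convex U" and inner: "zero_inner_point U"
  obtains r where "0 < r" "ball 0 r \<subseteq> closure U"
proof -
  have "0 \<in> U" using inner[unfolded zero_inner_point_def, rule_format, of 0] by auto
  have "interior (closure U) \<noteq> {}"
  proof
    assume empty: "interior (closure U) = {}"
    define F where "F n = (\<lambda>x. real (Suc n) *\<^sub>R x) ` closure U" for n
    have "closed (F n)" for n unfolding F_def by (intro closed_scaling) simp
    moreover have "interior (F n) = {}" for n
    proof (rule ccontr)
      assume "interior (F n) \<noteq> {}"
      then obtain T where T: "open T" "T \<subseteq> F n" "T \<noteq> {}"
        using open_interior interior_subset by blast
      have "(\<lambda>x. (1 / real (Suc n)) *\<^sub>R x) ` T \<subseteq> closure U"
        using T(2) by (auto simp: F_def)
      moreover have "open ((\<lambda>x. (1 / real (Suc n)) *\<^sub>R x) ` T)"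
        using T(1) by (intro open_scaling) auto
      ultimately have "(\<lambda>x. (1 / real (Suc n)) *\<^sub>R x) ` T \<subseteq> interior (closure U)"
        by (rule interior_maximal)
      with empty T(3) show False by auto
    qed
    moreover have "Met_TC.mcomplete TYPE('h)"
      by (simp add: complete_UNIV)
    ultimately have "interior (\<Union>(range F)) = {}"
      using Met_TC.metric_Baire_category_alt[of "range F"]
      by auto
    moreover have "\<Union>(range F) = UNIV"
    proof -
      have "y \<in> \<Union>(range F)" for y
      proof -
        obtain c where c: "0 < c" "c *\<^sub>R y \<in> U"
          using inner unfolding zero_inner_point_def by blast
        obtain n where n: "1 / c < real (Suc n)"
          using reals_Archimedean2[of "1/c"] by (metis less_trans lessI of_nat_less_iff)
        let ?t = "1 / (real (Suc n) * c)"
        have "0 \<le> ?t" "?t \<le> 1" using c n by (auto simp: field_simps)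
        then have "?t *\<^sub>R (c *\<^sub>R y) + (1 - ?t) *\<^sub>R 0 \<in> U"
          using c(2) \<open>0 \<in> U\<close> by (intro convexD[OF conv]) auto
        then have "(1 / real (Suc n)) *\<^sub>R y \<in> closure U"
          using c(1) closure_subset by auto
        then have "y \<in> F n" unfolding F_def by (rule rev_image_eqI) simp
        then show ?thesis by blast
      qed
      then show ?thesis by blast
    qed
    ultimately show False by simp
  qed
  then obtain x where x: "x \<in> interior (closure U)" by blast
  then obtain r where r: "0 < r" "ball x r \<subseteq> closure U" by (meson mem_interior)
  obtain c where c: "0 < c" "- (c *\<^sub>R x) \<in> U"
    using inner unfolding zero_inner_point_def by blast
  have "ball 0 (c / (1 + c) * r) \<subseteq> closure U"
  proof
    fix z :: 'h assume z: "z \<in> ball 0 (c / (1 + c) * r)"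
    let ?y = "x + ((1 + c) / c) *\<^sub>R z"
    have "?y \<in> ball x r"
      using z c(1) by (simp add: dist_norm field_simps)
    then have "?y \<in> closure U" "- (c *\<^sub>R x) \<in> closure U" using r(2) c(2) closure_subset by auto
    then have "(c / (1 + c)) *\<^sub>R ?y + (1 / (1 + c)) *\<^sub>R (- (c *\<^sub>R x)) \<in> closure U"
      using c(1) by (intro convexD[OF convex_closure[OF conv]]) (auto simp: field_simps)
    also have "(c / (1 + c)) *\<^sub>R ?y + (1 / (1 + c)) *\<^sub>R (- (c *\<^sub>R x)) = z"
      using c(1) by (simp add: scaleR_add_right)
    finally show "z \<in> closure U" .
  qed
  moreover have "0 < c / (1 + c) * r" using c(1) r(1) by simp
  ultimately show thesis using that by blast
qed

text \<open>
  Sort the points of \<open>U\<close> into finitely many cells according to the values of the functionals up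
  to a small error.  If no cell contained two distant points, then one point from each cell would
  give a finite net of \<open>U\<close>.  A dilated difference of two distant points of one cell lies in
  the ball inside \<open>closure U\<close>, and the required conditions are open.
\<close>

lemma almost_annihilated_points:
  fixes U :: "'h::{real_normed_vector, complete_space} set"
  assumes nc: "\<not> compact (closure U)" and bdd: "bounded U"
    and r: "0 < r" "ball 0 r \<subseteq> closure U"
  obtains \<rho> where "0 < \<rho>"
    "\<And>F \<eta>. finite F \<Longrightarrow> (\<And>\<phi>. \<phi> \<in> F \<Longrightarrow> bounded_linear \<phi>) \<Longrightarrow> 0 < \<eta> \<Longrightarrow>
      \<exists>\<theta>\<in>U. \<rho> \<le> norm \<theta> \<and> (\<forall>\<phi>\<in>F. \<bar>\<phi> \<theta> :: real\<bar> < \<eta>)"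
proof -
  obtain e where e: "0 < e" "\<And>k. finite k \<Longrightarrow> \<not> closure U \<subseteq> (\<Union>x\<in>k. ball x e)"
    using nc unfolding compact_eq_totally_bounded by (auto simp: complete_eq_closed)
  define \<delta> where "\<delta> = e / 2"
  have "0 < \<delta>" using e(1) by (simp add: \<delta>_def)
  have net: "\<exists>u\<in>U. \<forall>x\<in>k. \<delta> < dist x u" if "finite k" for k
  proof (rule ccontr)
    assume "\<not> ?thesis"
    then have "U \<subseteq> (\<Union>x\<in>k. cball x \<delta>)" by (auto simp: not_less)
    then have "closure U \<subseteq> (\<Union>x\<in>k. cball x \<delta>)"
      using that by (intro closure_minimal closed_UN) auto
    also have "\<dots> \<subseteq> (\<Union>x\<in>k. ball x e)" using e(1) by (auto simp: \<delta>_def)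
    finally show False using e(2)[OF that] by blast
  qed
  obtain D where D: "0 < D" "\<And>u. u \<in> U \<Longrightarrow> norm u \<le> D"
    using bdd by (auto simp: bounded_pos)
  \<comment> \<open>Differences of points of \<open>U\<close> have norm at most \<open>2 * D\<close>, so this factor brings them into the ball.\<close>
  define c where "c = r / (4 * D)"
  have "0 < c" using r(1) D(1) by (simp add: c_def)
  have main: "\<exists>\<theta>\<in>U. c * \<delta> / 2 \<le> norm \<theta> \<and> (\<forall>\<phi>\<in>F. \<bar>\<phi> \<theta> :: real\<bar> < \<eta>)"
    if F: "finite F" "\<And>\<phi>. \<phi> \<in> F \<Longrightarrow> bounded_linear \<phi>" and "0 < \<eta>" for F \<eta>
  proof -
    define \<eta>' where "\<eta>' = \<eta> / c"
    have "0 < \<eta>'" using \<open>0 < \<eta>\<close> \<open>0 < c\<close> by (simp add: \<eta>'_def)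
    define g where "g u = (\<lambda>\<phi>\<in>F. \<lfloor>\<phi> u / \<eta>'\<rfloor>)" for u
    have "\<exists>N. \<forall>u\<in>U. \<lfloor>\<phi> u / \<eta>'\<rfloor> \<in> {-N..N}" if "\<phi> \<in> F" for \<phi>
    proof -
      have "bounded (\<phi> ` U)" using bounded_linear_image[OF bdd F(2)[OF that]] .
      then obtain L where L: "\<And>u. u \<in> U \<Longrightarrow> \<bar>\<phi> u\<bar> \<le> L" by (auto simp: bounded_iff)
      have "\<lfloor>\<phi> u / \<eta>'\<rfloor> \<in> {- \<lceil>L / \<eta>'\<rceil> - 1..\<lceil>L / \<eta>'\<rceil> + 1}" if "u \<in> U" for u
      proof -
        have "\<bar>\<phi> u / \<eta>'\<bar> \<le> L / \<eta>'" using L[OF that] \<open>0 < \<eta>'\<close> by (simp add: divide_right_mono)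
        with floor_correct[of "\<phi> u / \<eta>'"] ceiling_correct[of "L / \<eta>'"] show ?thesis
          unfolding abs_le_iff atLeastAtMost_iff
          by (intro conjI) linarith+
      qed
      then show ?thesis by (intro exI[of _ "\<lceil>L / \<eta>'\<rceil> + 1"]) auto
    qed
    then obtain N where N: "\<And>\<phi> u. \<phi> \<in> F \<Longrightarrow> u \<in> U \<Longrightarrow> \<lfloor>\<phi> u / \<eta>'\<rfloor> \<in> {- N \<phi>..N \<phi>}"
      by metis
    have "g ` U \<subseteq> (\<Pi>\<^sub>E \<phi>\<in>F. {- N \<phi>..N \<phi>})" using N by (auto simp: g_def)
    then have "finite (g ` U)" by (rule finite_subset) (intro finite_PiE F(1), simp)
    then obtain u where u: "u \<in> U" "\<forall>x\<in>inv_into U g ` g ` U. \<delta> < dist x u"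
      using net[of "inv_into U g ` g ` U"] by auto
    define u' where "u' = inv_into U g (g u)"
    have u': "u' \<in> U" "g u' = g u"
      unfolding u'_def using u(1) by (auto intro: inv_into_into f_inv_into_f)
    have "\<delta> < norm (u - u')" using u unfolding u'_def by (auto simp: dist_norm norm_minus_commute)
    define y where "y = c *\<^sub>R (u - u')"
    have "norm (u - u') \<le> 2 * D"
      using norm_triangle_ineq4[of u u'] D(2)[OF u(1)] D(2)[OF u'(1)] by linarith
    then have "norm y \<le> c * (2 * D)" using \<open>0 < c\<close> by (simp add: y_def)
    also have "\<dots> < r" using r(1) D(1) by (simp add: c_def)
    finally have "y \<in> closure U" using r(2) by (auto simp: subset_iff)
    have y1: "c * \<delta> / 2 < norm y"
      using \<open>\<delta> < norm (u - u')\<close> \<open>0 < c\<close> \<open>0 < \<delta>\<close> mult_strict_left_mono[of \<delta> "norm (u - u')" c]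
        mult_pos_pos[of c \<delta>] by (simp add: y_def)
    have y2: "\<bar>\<phi> y\<bar> < \<eta>" if "\<phi> \<in> F" for \<phi>
    proof -
      interpret \<phi>: bounded_linear \<phi> by (rule F(2)[OF that])
      have "\<lfloor>\<phi> u / \<eta>'\<rfloor> = \<lfloor>\<phi> u' / \<eta>'\<rfloor>"
        using fun_cong[OF u'(2), of \<phi>] that by (simp add: g_def)
      then have "\<bar>\<phi> u / \<eta>' - \<phi> u' / \<eta>'\<bar> < 1" by linarith
      then have "\<bar>\<phi> u - \<phi> u'\<bar> < \<eta>'"
        using \<open>0 < \<eta>'\<close> by (simp add: diff_divide_distrib[symmetric] abs_divide)
      then have "c * \<bar>\<phi> u - \<phi> u'\<bar> < c * \<eta>'" using \<open>0 < c\<close> by simp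
      then show ?thesis using \<open>0 < c\<close> by (simp add: y_def \<phi>.scaleR \<phi>.diff abs_mult \<eta>'_def)
    qed
    define T where "T = {\<theta>. c * \<delta> / 2 < norm \<theta>} \<inter> (\<Inter>\<phi>\<in>F. {\<theta>. \<bar>\<phi> \<theta>\<bar> < \<eta>})"
    have "open T"
      unfolding T_def
      by (intro open_Int open_INT F(1) ballI open_Collect_less continuous_intros
          linear_continuous_on F(2))
    moreover have "y \<in> T" using y1 y2 by (auto simp: T_def)
    ultimately have "T \<inter> U \<noteq> {}"
      using \<open>y \<in> closure U\<close> open_Int_closure_eq_empty[of T U] by blast
    then show ?thesis by (auto simp: T_def intro: less_imp_le)
  qed
  moreover have "0 < c * \<delta> / 2" using \<open>0 < c\<close> \<open>0 < \<delta>\<close> by simp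
  ultimately show thesis using that by blast
qed

section \<open>Measures determined by the integrals of cosines\<close>

text \<open>
  The phases \<open>0\<close> and \<open>- pi / 2\<close> give the real and imaginary parts of the characteristic function, and
  Levy's uniqueness theorem applies after division by the common total mass.
\<close>

lemma finite_real_measure_eqI_cos:
  fixes M N :: "real measure"
  assumes fin: "finite_measure M" "finite_measure N"
    and sets: "sets M = sets borel" "sets N = sets borel"
    and eq: "\<And>t b. (\<integral>x. cos (t * x + b) \<partial>M) = (\<integral>x. cos (t * x + b) \<partial>N)"
  shows "M = N"
proof -
  interpret M: finite_measure M by fact
  interpret N: finite_measure N by fact
  have space: "space M = UNIV" "space N = UNIV" using sets[THEN sets_eq_imp_space_eq] by auto
  define c where "c = measure M UNIV"
  have c: "measure N UNIV = c" using eq[of 0 0] by (simp add: c_def space)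
  show ?thesis
  proof (cases "c = 0")
    case True
    have "emeasure M A = 0" "emeasure N A = 0" for A
      using True c M.finite_measure_mono[of A UNIV] N.finite_measure_mono[of A UNIV]
      by (auto simp: c_def M.emeasure_eq_measure N.emeasure_eq_measure space sets measure_notin_sets
            intro!: antisym)
    then show ?thesis by (intro measure_eqI) (auto simp: sets)
  next
    case False
    then have "0 < c" unfolding c_def by (simp add: less_le)
    define P where "P R = scale_measure (ennreal (1 / c)) R" for R :: "real measure"
    have P: "real_distribution (P R)"
      and char: "\<And>t. char (P R) t = Complex ((\<integral>x. cos (t * x + 0) \<partial>R) / c) ((\<integral>x. cos (t * x + (- pi / 2)) \<partial>R) / c)"
      if R: "finite_measure R" "sets R = sets borel" "measure R UNIV = c" for R
    proof -
      interpret R: finite_measure R by fact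
      have sp: "space R = UNIV" using sets_eq_imp_space_eq[OF R(2)] by simp
      show "real_distribution (P R)"
      proof (intro real_distribution.intro prob_spaceI real_distribution_axioms.intro)
        show "emeasure (P R) (space (P R)) = 1"
          using \<open>0 < c\<close> R(3)
          by (simp add: P_def space_scale_measure sp R.emeasure_eq_measure ennreal_mult[symmetric])
      qed (simp add: P_def R(2))
      have P_dens: "P R = density R (\<lambda>_. ennreal (1 / c))"
        by (rule measure_eqI) (auto simp: P_def emeasure_density nn_integral_cmult_indicator)
      have [measurable_cong]: "sets R = sets borel" by fact
      have ic: "integrable R (\<lambda>x. cos (t * x))" "integrable R (\<lambda>x. sin (t * x))" for t
        by (intro R.integrable_const_bound[where B = 1] AE_I2; simp)+
      have "complex_integrable R (\<lambda>x. iexp (t * x))" for t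
        by (intro R.integrable_const_bound[where B = 1] AE_I2) (simp_all del: of_real_mult)
      fix t
      have "char (P R) t = (CLINT x|R. (1 / c) *\<^sub>R iexp (t * x))"
        unfolding char_def P_dens using \<open>0 < c\<close> by (subst integral_density) auto
      also have "\<dots> = (1 / c) *\<^sub>R (CLINT x|R. iexp (t * x))" by (rule integral_scaleR_right)
      also have "(CLINT x|R. iexp (t * x)) = Complex (\<integral>x. cos (t * x) \<partial>R) (\<integral>x. sin (t * x) \<partial>R)"
      proof (rule complex_eqI)
        show "Re (CLINT x|R. iexp (t * x)) = Re (Complex (\<integral>x. cos (t * x) \<partial>R) (\<integral>x. sin (t * x) \<partial>R))"
          using integral_Re[OF \<open>complex_integrable R (\<lambda>x. iexp (t * x))\<close>] by (simp add: Re_exp)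
        show "Im (CLINT x|R. iexp (t * x)) = Im (Complex (\<integral>x. cos (t * x) \<partial>R) (\<integral>x. sin (t * x) \<partial>R))"
          using integral_Im[OF \<open>complex_integrable R (\<lambda>x. iexp (t * x))\<close>] by (simp add: Im_exp)
      qed
      finally show "char (P R) t
          = Complex ((\<integral>x. cos (t * x + 0) \<partial>R) / c) ((\<integral>x. cos (t * x + (- pi / 2)) \<partial>R) / c)"
        by (simp add: cos_diff complex_eq_iff)
    qed
    have "P M = P N"
    proof (rule Levy_uniqueness)
      show "real_distribution (P M)" "real_distribution (P N)"
        using P[OF fin(1) sets(1) c_def[symmetric]] P[OF fin(2) sets(2) c] .
      show "char (P M) = char (P N)"
        by (rule ext)
          (simp only: char[OF fin(1) sets(1) c_def[symmetric]] char[OF fin(2) sets(2) c] eq)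
    qed
    show ?thesis
    proof (rule measure_eqI)
      fix A assume "A \<in> sets M"
      have "emeasure (P M) A = emeasure (P N) A" using \<open>P M = P N\<close> by simp
      then show "emeasure M A = emeasure N A"
        using \<open>0 < c\<close>
        by (simp add: P_def M.emeasure_eq_measure N.emeasure_eq_measure ennreal_mult[symmetric])
    qed (simp add: sets)
  qed
qed

text \<open>
  Uniqueness is applied to the image under \<open>X\<close> of the measure with density \<open>w\<close> and to the image under
  \<open>Y\<close> of the measure with density \<open>v\<close>.
\<close>

lemma weighted_integral_eqI_cos:
  fixes X :: "'a \<Rightarrow> real" and Y :: "'b \<Rightarrow> real" and f :: "real \<Rightarrow> real"
  assumes [measurable]: "X \<in> borel_measurable M" "Y \<in> borel_measurable N" "f \<in> borel_measurable borel"
    and w: "integrable M w" "\<And>x. 0 \<le> w x" and v: "integrable N v" "\<And>x. 0 \<le> v x"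
    and eq: "\<And>t b. (\<integral>x. w x * cos (t * X x + b) \<partial>M) = (\<integral>x. v x * cos (t * Y x + b) \<partial>N)"
  shows "(\<integral>x. w x * f (X x) \<partial>M) = (\<integral>x. v x * f (Y x) \<partial>N)"
proof -
  have [measurable]: "w \<in> borel_measurable M" "v \<in> borel_measurable N" using w(1) v(1) by auto
  have law: "(\<integral>x. g x \<partial>distr (density M w) borel X) = (\<integral>x. w x * g (X x) \<partial>M)"
            "(\<integral>x. g x \<partial>distr (density N v) borel Y) = (\<integral>x. v x * g (Y x) \<partial>N)"
    if [measurable]: "g \<in> borel_measurable borel" for g :: "real \<Rightarrow> real"
    by (simp_all add: integral_distr integral_real_density w(2) v(2))
  have "distr (density M w) borel X = distr (density N v) borel Y"
  proof (rule finite_real_measure_eqI_cos)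
    have "finite_measure (density M w)"
      using w by (intro finite_measureI) (simp add: emeasure_density nn_integral_eq_integral cong: nn_integral_cong)
    then show "finite_measure (distr (density M w) borel X)"
      by (rule finite_measure.finite_measure_distr) simp
    have "finite_measure (density N v)"
      using v by (intro finite_measureI) (simp add: emeasure_density nn_integral_eq_integral cong: nn_integral_cong)
    then show "finite_measure (distr (density N v) borel Y)"
      by (rule finite_measure.finite_measure_distr) simp
  qed (simp_all add: law eq)
  with law[of f] show ?thesis by simp
qed

text \<open>
  Cosines of linear forms in finitely many coordinates can be replaced, one coordinate at a time,
  by indicators of Borel sets in that coordinate: the product of the factors already treated
  serves as a weight in the one-dimensional statement, and products of cosines are sums of
  cosines.  The constant \<open>2\<close> makes the weight positive.
\<close>

lemma product_measure_eqI_cos: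
  fixes P Q :: "('i \<Rightarrow> real) measure"
  assumes prob: "prob_space P" "prob_space Q"
    and sets: "sets P = sets (PiM UNIV (\<lambda>_. borel))" "sets Q = sets (PiM UNIV (\<lambda>_. borel))"
    and eq: "\<And>xs a. (\<integral>y. cos ((\<Sum>(t, j)\<leftarrow>xs. t * y j) + a) \<partial>P)
                   = (\<integral>y. cos ((\<Sum>(t, j)\<leftarrow>xs. t * y j) + a) \<partial>Q)"
  shows "P = Q"
proof -
  interpret P: prob_space P by fact
  interpret Q: prob_space Q by fact
  have [measurable_cong]: "sets P = sets (PiM UNIV (\<lambda>_. borel))"
    "sets Q = sets (PiM UNIV (\<lambda>_. borel))" by fact+
  define l where "l xs y = (\<Sum>(t, j)\<leftarrow>xs. t * y j)" for xs :: "(real \<times> 'i) list" and y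
  have [measurable]: "l xs \<in> borel_measurable (PiM UNIV (\<lambda>_. borel))" for xs
    unfolding l_def by (induction xs) auto
  have cyl: "(\<integral>y. (\<Prod>i\<in>I. indicator (A i) (y i)) * cos (l xs y + a) \<partial>P)
           = (\<integral>y. (\<Prod>i\<in>I. indicator (A i) (y i)) * cos (l xs y + a) \<partial>Q)"
    if "finite I" "\<And>i. i \<in> I \<Longrightarrow> A i \<in> sets borel" for I xs a and A :: "'i \<Rightarrow> real set"
    using that
  proof (induction I arbitrary: xs a rule: finite_induct)
    case empty
    then show ?case using eq by (simp add: l_def)
  next
    case (insert i I)
    have [measurable]: "A j \<in> sets borel" if "j \<in> insert i I" for j using insert.prems that .
    define p where "p y = (\<Prod>j\<in>I. indicator (A j) (y j) :: real)" for y
    have [measurable]: "p \<in> borel_measurable (PiM UNIV (\<lambda>_. borel))"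
      unfolding p_def by (intro borel_measurable_prod borel_measurable_indicator') auto
    have p01: "0 \<le> p y" "p y \<le> 1" for y
      unfolding p_def by (auto intro!: prod_nonneg prod_le_1)
    define w where "w y = 2 + p y * cos (l xs y + a)" for y
    have [measurable]: "w \<in> borel_measurable (PiM UNIV (\<lambda>_. borel))" unfolding w_def by measurable
    have bound: "\<bar>p y * cos z\<bar> \<le> 1" for y z
      using p01[of y] mult_mono[of "\<bar>p y\<bar>" 1 "\<bar>cos z\<bar>" 1] by (simp add: abs_mult)
    have w13: "0 \<le> w y" "\<bar>w y\<bar> \<le> 3" for y
      using bound[of y "l xs y + a"] unfolding w_def by auto
    have intble: "integrable R w" "integrable R (\<lambda>y. p y * cos (l ys y + b))"
       "integrable R (\<lambda>y. cos (l ys y + b))" "integrable R (\<lambda>y. indicator (A i) (y i) :: real)"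
       "integrable R (\<lambda>y. (p y * cos (l ys y + b)) * indicator (A i) (y i))"
      if "prob_space R" and [measurable_cong]: "sets R = sets (PiM UNIV (\<lambda>_. borel))" for R ys b
    proof -
      interpret R: prob_space R by fact
      show "integrable R w"
        by (rule R.integrable_const_bound[where B = 3]) (use w13 in auto)
      show int: "integrable R (\<lambda>y. p y * cos (l ys y + b))"
        by (rule R.integrable_const_bound[where B = 1]) (use bound in auto)
      show "integrable R (\<lambda>y. cos (l ys y + b))"
        by (rule R.integrable_const_bound[where B = 1]) auto
      show "integrable R (\<lambda>y. indicator (A i) (y i) :: real)"
        by (rule R.integrable_const_bound[where B = 1]) (auto simp: indicator_def)
      show "integrable R (\<lambda>y. (p y * cos (l ys y + b)) * indicator (A i) (y i))"
        by (rule Bochner_Integration.integrable_bound[OF int]) (auto simp: indicator_def)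
    qed
    have IH: "(\<integral>y. p y * cos (l ys y + b) \<partial>P) = (\<integral>y. p y * cos (l ys y + b) \<partial>Q)" for ys b
      unfolding p_def by (rule insert.IH) (use insert.prems in auto)
    have expand: "(\<integral>y. w y * cos (t * y i + b) \<partial>R)
        = 2 * (\<integral>y. cos (l [(t, i)] y + b) \<partial>R)
          + (1/2) * ((\<integral>y. p y * cos (l ((- t, i) # xs) y + (a - b)) \<partial>R)
                   + (\<integral>y. p y * cos (l ((t, i) # xs) y + (a + b)) \<partial>R))"
      if R: "prob_space R" "sets R = sets (PiM UNIV (\<lambda>_. borel))" for R t b
    proof -
      have "w y * cos (t * y i + b) = 2 * cos (l [(t, i)] y + b)
          + (1/2) * (p y * cos (l ((- t, i) # xs) y + (a - b)) + p y * cos (l ((t, i) # xs) y + (a + b)))" for y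
      proof -
        let ?u = "l xs y + a" and ?v = "t * y i + b"
        have forms: "l ((- t, i) # xs) y + (a - b) = ?u - ?v"
          "l ((t, i) # xs) y + (a + b) = ?u + ?v" "l [(t, i)] y + b = ?v"
          by (simp_all add: l_def)
        have "w y * cos ?v = 2 * cos ?v + p y * (cos ?u * cos ?v)"
          unfolding w_def by (simp only: distrib_right mult.assoc)
        then show ?thesis unfolding forms cos_times_cos by (simp add: ring_distribs(1)[of "p y"])
      qed
      then show ?thesis by (simp add: intble[OF R])
    qed
    have "(\<integral>y. w y * indicator (A i) (y i) \<partial>P) = (\<integral>y. w y * indicator (A i) (y i) \<partial>Q)"
    proof (rule weighted_integral_eqI_cos[where f = "indicator (A i)"])
      show "(\<integral>y. w y * cos (t * y i + b) \<partial>P) = (\<integral>y. w y * cos (t * y i + b) \<partial>Q)" for t b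
        unfolding expand[OF prob(1) sets(1)] expand[OF prob(2) sets(2)] IH
        using eq[of "[(t, i)]" b] by (simp add: l_def)
    qed (use intble(1)[OF prob(1) sets(1)] intble(1)[OF prob(2) sets(2)] w13 in auto)
    moreover have "(\<integral>y. indicator (A i) (y i) \<partial>P) = (\<integral>y. indicator (A i) (y i) \<partial>Q :: real)"
      using weighted_integral_eqI_cos[of "\<lambda>y. y i" P "\<lambda>y. y i" Q "indicator (A i)" "\<lambda>_. 1" "\<lambda>_. 1"]
        eq[of "[(_, i)]"] by simp
    moreover have "(\<integral>y. w y * indicator (A i) (y i) \<partial>R) = 2 * (\<integral>y. indicator (A i) (y i) \<partial>R)
        + (\<integral>y. (p y * cos (l xs y + a)) * indicator (A i) (y i) \<partial>R)"
      if R: "prob_space R" "sets R = sets (PiM UNIV (\<lambda>_. borel))" for R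
      unfolding w_def distrib_right using intble[OF R] by simp
    ultimately show ?case
      using insert.hyps prob sets by (simp add: p_def mult_ac)
  qed
  show ?thesis
  proof (rule measure_eqI_PiM_infinite[OF sets])
    fix A :: "'i \<Rightarrow> real set" and J
    assume J: "finite J" "\<And>i. i \<in> J \<Longrightarrow> A i \<in> sets borel"
    let ?E = "prod_emb UNIV (\<lambda>_. borel) J (Pi\<^sub>E J A)"
    have E: "?E \<in> sets (PiM UNIV (\<lambda>_. borel))" using J by (intro sets_PiM_I) auto
    have ind: "(\<Prod>i\<in>J. indicator (A i) (y i) :: real) = indicator ?E y" for y
      using J(1) by (auto simp: prod_emb_def indicator_def PiE_iff prod_zero_iff)
    have "(\<integral>y. (\<Prod>i\<in>J. indicator (A i) (y i)) * cos (l [] y + 0) \<partial>P)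
        = (\<integral>y. (\<Prod>i\<in>J. indicator (A i) (y i)) * cos (l [] y + 0) \<partial>Q)"
      by (rule cyl) (use J in auto)
    then have "(\<integral>y. indicator ?E y \<partial>P) = (\<integral>y. indicator ?E y \<partial>Q :: real)"
      by (simp add: l_def ind)
    moreover have "space P = UNIV" "space Q = UNIV"
      using sets[THEN sets_eq_imp_space_eq] by (auto simp: space_PiM)
    ultimately have "measure P ?E = measure Q ?E" by simp
    then show "emeasure P ?E = emeasure Q ?E"
      by (simp add: P.emeasure_eq_measure Q.emeasure_eq_measure)
  qed (simp add: P.finite_measure_axioms)
qed

text \<open>The form in which uniqueness is used: identification of a likelihood ratio.\<close>

lemma (in prob_space) likelihood_ratioI_cos:
  fixes Y Z :: "'a \<Rightarrow> 'i \<Rightarrow> real" and K :: "('i \<Rightarrow> real) \<Rightarrow> real"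
  assumes [measurable]: "\<And>i. (\<lambda>x. Y x i) \<in> borel_measurable M" "\<And>i. (\<lambda>x. Z x i) \<in> borel_measurable M"
      "K \<in> borel_measurable (PiM UNIV (\<lambda>_. borel))"
    and L: "integrable M L" "\<And>x. 0 \<le> L x"
    and eq: "\<And>xs a. (\<integral>x. cos ((\<Sum>(t, j)\<leftarrow>xs. t * Y x j) + a) \<partial>M)
                   = (\<integral>x. L x * cos ((\<Sum>(t, j)\<leftarrow>xs. t * Z x j) + a) \<partial>M)"
  shows "(\<integral>x. K (Y x) \<partial>M) = (\<integral>x. L x * K (Z x) \<partial>M)"
proof -
  let ?S = "PiM (UNIV :: 'i set) (\<lambda>_. borel :: real measure)"
  have [measurable]: "L \<in> borel_measurable M" using L(1) by auto
  have [measurable]: "Y \<in> measurable M ?S" "Z \<in> measurable M ?S"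
    by (auto intro!: measurable_PiM_single' simp: space_PiM)
  have [measurable]: "(\<lambda>y. cos ((\<Sum>(t, j)\<leftarrow>xs. t * y j) + a)) \<in> borel_measurable ?S" for xs a
  proof -
    have [measurable]: "(\<lambda>y. (\<Sum>(t, j)\<leftarrow>xs. t * y j)) \<in> borel_measurable ?S"
      by (induction xs) auto
    show ?thesis by measurable
  qed
  have "(\<integral>x. L x \<partial>M) = 1" using eq[of "[]" 0] by (simp add: prob_space)
  then have "prob_space (density M L)"
    using L by (intro prob_spaceI)
      (simp add: emeasure_density nn_integral_eq_integral cong: nn_integral_cong)
  have "distr M ?S Y = distr (density M L) ?S Z"
  proof (rule product_measure_eqI_cos)
    show "prob_space (distr M ?S Y)" by (rule prob_space_distr) simp
    show "prob_space (distr (density M L) ?S Z)"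
      using \<open>prob_space (density M L)\<close> by (rule prob_space.prob_space_distr) simp
  qed (simp_all add: integral_distr integral_real_density L(2) eq)
  then have "(\<integral>y. K y \<partial>distr M ?S Y) = (\<integral>y. K y \<partial>distr (density M L) ?S Z)" by simp
  then show ?thesis by (simp add: integral_distr integral_real_density L(2))
qed

section \<open>Normal variables\<close>

lemma integral_std_normal_cos:
  "(\<integral>x. cos (t * x + a) \<partial>std_normal_distribution) = cos a * exp (- t\<^sup>2 / 2)"
proof -
  interpret real_distribution std_normal_distribution by (rule real_dist_normal_dist)
  have int: "complex_integrable std_normal_distribution (\<lambda>x. iexp (t * x))"
    by (intro integrable_const_bound[where B = 1] AE_I2) (simp_all del: of_real_mult)
  have c: "(CLINT x|std_normal_distribution. iexp (t * x)) = complex_of_real (exp (- t\<^sup>2 / 2))"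
    using fun_cong[OF char_std_normal_distribution, of t] by (simp add: char_def)
  have "(\<integral>x. cos (t * x) \<partial>std_normal_distribution) = exp (- t\<^sup>2 / 2)"
    using integral_Re[OF int] unfolding c by (simp add: Re_exp)
  moreover have "(\<integral>x. sin (t * x) \<partial>std_normal_distribution) = 0"
    using integral_Im[OF int] unfolding c by (simp add: Im_exp)
  moreover have "integrable std_normal_distribution (\<lambda>x. cos (t * x))"
      "integrable std_normal_distribution (\<lambda>x. sin (t * x))"
    by (intro integrable_const_bound[where B = 1] AE_I2; simp)+
  ultimately show ?thesis by (simp add: cos_add mult.commute)
qed

lemma integral_std_normal_abs: "(\<integral>x. \<bar>x\<bar> \<partial>std_normal_distribution) \<le> 1"
proof -
  have "(\<integral>x. \<bar>x\<bar> \<partial>std_normal_distribution) = sqrt (2 / pi)"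
    using std_normal_distribution_odd_moments_abs[of 0] by simp
  also have "\<dots> \<le> 1" using pi_ge_two by simp
  finally show ?thesis .
qed

text \<open>
  Completing the square: the tilt by \<open>exp (s * x)\<close> moves the mean of the normal law from \<open>0\<close> to \<open>s\<close>.
\<close>

lemma std_normal_exponential_tilt:
  assumes [measurable]: "f \<in> borel_measurable borel"
  shows "(\<integral>x. exp (s * x) * f x \<partial>std_normal_distribution)
       = exp (s\<^sup>2 / 2) * (\<integral>x. f (s + x) \<partial>std_normal_distribution)"
proof -
  have "std_normal_density (s + x) * exp (s * (s + x)) = exp (s\<^sup>2 / 2) * std_normal_density x" for x
  proof -
    have "- (s + x)\<^sup>2 / 2 + s * (s + x) = s\<^sup>2 / 2 + - x\<^sup>2 / 2"
      by (simp add: power2_eq_square field_simps)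
    then have "exp (- (s + x)\<^sup>2 / 2) * exp (s * (s + x)) = exp (s\<^sup>2 / 2) * exp (- x\<^sup>2 / 2)"
      unfolding exp_add[symmetric] by simp
    then show ?thesis by (simp add: std_normal_density_def mult.assoc)
  qed
  then have shift: "std_normal_density (s + x) * (exp (s * (s + x)) * f (s + x))
      = exp (s\<^sup>2 / 2) * (std_normal_density x * f (s + x))" for x
    by (metis mult.assoc)
  have "(\<integral>x. exp (s * x) * f x \<partial>std_normal_distribution)
      = (\<integral>x. std_normal_density x * (exp (s * x) * f x) \<partial>lborel)"
    by (simp add: integral_real_density)
  also have "\<dots> = (\<integral>x. std_normal_density (s + x) * (exp (s * (s + x)) * f (s + x)) \<partial>lborel)"
    using lborel_integral_real_affine[of 1 "\<lambda>x. std_normal_density x * (exp (s * x) * f x)" s] by simp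
  also have "\<dots> = exp (s\<^sup>2 / 2) * (\<integral>x. f (s + x) \<partial>std_normal_distribution)"
    by (simp add: shift integral_real_density)
  finally show ?thesis .
qed

lemma abs_cos_diff: "\<bar>cos x - cos y\<bar> \<le> \<bar>x - y :: real\<bar>"
proof -
  have "\<bar>cos x - cos y\<bar> = 2 * (\<bar>sin ((x + y) / 2)\<bar> * \<bar>sin ((y - x) / 2)\<bar>)"
    by (simp add: cos_diff_cos abs_mult)
  also have "\<dots> \<le> 2 * (1 * \<bar>(y - x) / 2\<bar>)"
    by (intro mult_left_mono mult_mono abs_sin_x_le_abs_x) auto
  finally show ?thesis by simp
qed

text \<open>
  A law is written as the image of the standard normal law under a dilation, so that the point mass
  at \<open>0\<close> is the case \<open>s = 0\<close>.
\<close>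

lemma gaussian_variable_law:
  assumes M: "prob_space M" and X: "gaussian_variable M X"
    and mean: "(\<integral>w. X w \<partial>M) = 0" and var: "(\<integral>w. X w * X w \<partial>M) = s\<^sup>2" "0 \<le> s"
  shows "distr M borel X = distr std_normal_distribution borel (\<lambda>x. s * x)"
proof -
  interpret prob_space M by fact
  have [measurable]: "X \<in> borel_measurable M" using X by (simp add: gaussian_variable_def)
  consider m r where "0 < r" "distributed M lborel X (normal_density m r)" | m where "AE w in M. X w = m"
    using X by (auto simp: gaussian_variable_def)
  then show ?thesis
  proof cases
    case (1 m r)
    have "m = 0" using normal_distributed_expectation[OF 1] mean by simp
    then have "r\<^sup>2 = s\<^sup>2"
      using normal_distributed_variance[OF 1] mean var(1) by (simp add: power2_eq_square)
    then have "r = s" using 1(1) var(2) by (simp add: power2_eq_iff_nonneg)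
    then have "0 < s" using 1(1) by simp
    have "distributed M lborel (\<lambda>w. X w / s) std_normal_density"
      using 1 \<open>m = 0\<close> \<open>r = s\<close> normal_standard_normal_convert[of r X m] by simp
    then have "std_normal_distribution = distr M lborel (\<lambda>w. X w / s)"
      by (simp add: distributed_distr_eq_density)
    then have "distr std_normal_distribution borel (\<lambda>x. s * x) = distr M borel ((\<lambda>x. s * x) \<circ> (\<lambda>w. X w / s))"
      by (simp add: distr_distr)
    also have "(\<lambda>x. s * x) \<circ> (\<lambda>w. X w / s) = X" using \<open>0 < s\<close> by (auto simp: fun_eq_iff)
    finally show ?thesis by simp
  next
    case (2 m)
    have "(\<integral>w. X w \<partial>M) = (\<integral>w. m \<partial>M)" by (rule integral_cong_AE) (use 2 in auto)
    then have "m = 0" using mean by (simp add: prob_space)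
    have "(\<integral>w. X w * X w \<partial>M) = (\<integral>w. 0 \<partial>M)" by (rule integral_cong_AE) (use 2 \<open>m = 0\<close> in auto)
    then have "s = 0" using var by simp
    have "distr M borel X = distr M borel (\<lambda>w. 0)"
      by (rule distr_cong_AE) (use 2 \<open>m = 0\<close> in auto)
    also have "\<dots> = return borel 0" by simp
    also have "\<dots> = distr std_normal_distribution borel (\<lambda>x. 0)"
      using prob_space.distr_const[OF real_distribution.axioms(1)[OF real_dist_normal_dist], of 0 borel]
      by (rule sym) simp
    finally show ?thesis by (simp add: \<open>s = 0\<close>)
  qed
qed

section \<open>The Gaussian field over the Hilbert space\<close>

text \<open>
  The square root \<open>S\<close> of the covariance operator turns the noise into a field whose coordinate at
  \<open>h\<close> has the law of \<open>norm (S h)\<close> times a standard normal variable.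
\<close>

locale gaussian_field = prob_space M for M :: "'w measure" +
  fixes \<xi> :: "'h::{real_inner, complete_space} \<Rightarrow> 'w \<Rightarrow> real" and S :: "'h \<Rightarrow> 'h"
  assumes positive_S: "positive_operator S"
    and kernel_S: "S x = 0 \<Longrightarrow> x = 0"
    and measurable_noise [measurable]: "\<xi> h \<in> borel_measurable M"
    and noise_linear: "AE w in M. \<xi> (a *\<^sub>R g + b *\<^sub>R h) w = a * \<xi> g w + b * \<xi> h w"
    and noise_law: "distr M borel (\<xi> h) = distr std_normal_distribution borel (\<lambda>x. norm (S h) * x)"
begin

sublocale S: bounded_linear S by (rule positive_operatorD(1)[OF positive_S])

lemma S_inner: "S x \<bullet> y = x \<bullet> S y"
  by (rule positive_operatorD(2)[OF positive_S])

lemma dense_S: "closure (range S) = UNIV"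
  by (rule dense_range_of_injective_selfadjoint[OF S.bounded_linear_axioms S_inner kernel_S])

lemma law_integral:
  assumes "X \<in> borel_measurable M" "distr M borel X = distr std_normal_distribution borel (\<lambda>x. s * x)"
    and [measurable]: "f \<in> borel_measurable borel"
  shows "(\<integral>w. f (X w) \<partial>M) = (\<integral>x. f (s * x) \<partial>std_normal_distribution :: real)"
    and "integrable M (\<lambda>w. f (X w)) = integrable std_normal_distribution (\<lambda>x. f (s * x))"
proof -
  have [measurable]: "X \<in> borel_measurable M" by fact
  show "(\<integral>w. f (X w) \<partial>M) = (\<integral>x. f (s * x) \<partial>std_normal_distribution :: real)"
    using arg_cong[OF assms(2), of "\<lambda>N. integral\<^sup>L N f"] by (simp add: integral_distr)
  show "integrable M (\<lambda>w. f (X w)) = integrable std_normal_distribution (\<lambda>x. f (s * x))"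
    using arg_cong[OF assms(2), of "\<lambda>N. integrable N f"] by (simp add: integrable_distr_eq)
qed

lemma noise_integrable: "integrable M (\<xi> h)"
proof -
  have "integrable std_normal_distribution (\<lambda>x. norm (S h) * x)"
    using integrable_std_normal_distribution_moment[of 1] by simp
  then show ?thesis using law_integral(2)[OF measurable_noise noise_law, of "\<lambda>x. x"] by simp
qed

lemma noise_abs: "(\<integral>w. \<bar>\<xi> h w\<bar> \<partial>M) \<le> norm (S h)"
proof -
  have "(\<integral>w. \<bar>\<xi> h w\<bar> \<partial>M) = (\<integral>x. \<bar>norm (S h) * x\<bar> \<partial>std_normal_distribution)"
    by (rule law_integral(1)[OF measurable_noise noise_law]) simp
  also have "\<dots> = norm (S h) * (\<integral>x. \<bar>x\<bar> \<partial>std_normal_distribution)"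
    by (simp add: abs_mult)
  also have "\<dots> \<le> norm (S h)"
    using integral_std_normal_abs by (intro mult_left_le) auto
  finally show ?thesis .
qed

lemma noise_cos: "(\<integral>w. cos (t * \<xi> h w + a) \<partial>M) = cos a * exp (- (t * norm (S h))\<^sup>2 / 2)"
  using law_integral(1)[OF measurable_noise noise_law, of "\<lambda>x. cos (t * x + a)" h]
    integral_std_normal_cos[of "t * norm (S h)" a] by (simp add: mult.assoc)

lemma noise_diff: "AE w in M. \<xi> (g - h) w = \<xi> g w - \<xi> h w"
  using noise_linear[of 1 g "-1" h] by simp

lemma noise_diff_abs: "(\<integral>w. \<bar>\<xi> g w - \<xi> h w\<bar> \<partial>M) \<le> norm (S g - S h)"
proof -
  have "(\<integral>w. \<bar>\<xi> g w - \<xi> h w\<bar> \<partial>M) = (\<integral>w. \<bar>\<xi> (g - h) w\<bar> \<partial>M)"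
    by (rule integral_cong_AE) (use noise_diff[of g h] in auto)
  also have "\<dots> \<le> norm (S (g - h))" by (rule noise_abs)
  finally show ?thesis by (simp add: S.diff)
qed

subsection \<open>Extension to an isonormal field\<close>

text \<open>
  The map \<open>S h \<mapsto> \<xi> h\<close> is a contraction from the dense range of \<open>S\<close> into \<open>L\<^sup>1\<close>, and it extends
  to the whole space: along a sequence with \<open>S (g k)\<close> converging geometrically to \<open>v\<close>, the
  variables \<open>\<xi> (g k)\<close> converge almost surely, and Fatou's lemma gives the estimate for the limit.
\<close>

lemma isonormal_extension:
  "\<exists>X. integrable M X \<and> (\<forall>h. (\<integral>w. \<bar>X w - \<xi> h w\<bar> \<partial>M) \<le> norm (v - S h))"
proof -
  have "\<exists>h. norm (v - S h) < (1/2)^k" for k :: nat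
  proof -
    have "v \<in> closure (range S)" using dense_S by simp
    then have "\<exists>y\<in>range S. dist y v < (1/2)^k" by (auto simp: closure_approachable)
    then show ?thesis by (auto simp: dist_norm norm_minus_commute)
  qed
  then obtain g where g: "\<And>k. norm (v - S (g k)) < (1/2)^k" by metis
  define d where "d k w = \<xi> (g (Suc k)) w - \<xi> (g k) w" for k w
  have [measurable]: "d k \<in> borel_measurable M" for k unfolding d_def by measurable
  have int_d: "integrable M (d k)" for k
    unfolding d_def by (intro Bochner_Integration.integrable_diff noise_integrable)
  have d_le: "(\<integral>w. \<bar>d k w\<bar> \<partial>M) \<le> 2 * (1/2)^k" for k
  proof -
    have "(\<integral>w. \<bar>d k w\<bar> \<partial>M) \<le> norm (S (g (Suc k)) - S (g k))"
      unfolding d_def by (rule noise_diff_abs)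
    also have "\<dots> \<le> norm (v - S (g (Suc k))) + norm (v - S (g k))"
      using norm_triangle_ineq4[of "v - S (g k)" "v - S (g (Suc k))"] by simp
    also have "\<dots> \<le> 2 * (1/2)^k" 
      using g[of k] g[of "Suc k"] zero_less_power[of "1/2::real" k] unfolding power_Suc by linarith
    finally show ?thesis .
  qed
  have "summable (\<lambda>k. \<integral>w. \<bar>d k w\<bar> \<partial>M)"
  proof (rule summable_comparison_test)
    show "\<exists>N. \<forall>n\<ge>N. norm (\<integral>w. \<bar>d n w\<bar> \<partial>M) \<le> 2 * (1/2)^n" using d_le by auto
    show "summable (\<lambda>n. 2 * (1/2::real)^n)" by (intro summable_mult summable_geometric) simp
  qed
  then have "(\<Sum>k. ennreal (\<integral>w. \<bar>d k w\<bar> \<partial>M)) \<noteq> top"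
    by (intro ennreal_suminf_neq_top) auto
  also have "(\<Sum>k. ennreal (\<integral>w. \<bar>d k w\<bar> \<partial>M)) = (\<integral>\<^sup>+w. (\<Sum>k. ennreal \<bar>d k w\<bar>) \<partial>M)"
    using int_d by (simp add: nn_integral_suminf nn_integral_eq_integral)
  finally have "AE w in M. (\<Sum>k. ennreal \<bar>d k w\<bar>) \<noteq> \<infinity>"
    by (intro nn_integral_noteq_infinite) auto
  then have conv: "AE w in M. convergent (\<lambda>k. \<xi> (g k) w)"
  proof eventually_elim
    case (elim w)
    then have "summable (\<lambda>k. \<bar>d k w\<bar>)" by (intro summable_suminf_not_top) auto
    then have "summable (\<lambda>k. d k w)" by (rule summable_rabs_cancel)
    then have "convergent (\<lambda>n. \<Sum>k<n. d k w)" by (simp add: summable_iff_convergent)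
    then have "convergent (\<lambda>n. \<xi> (g n) w - \<xi> (g 0) w)" by (simp add: d_def sum_lessThan_telescope[of "\<lambda>k. \<xi> (g k) w"])
    then have "convergent (\<lambda>n. (\<xi> (g n) w - \<xi> (g 0) w) + \<xi> (g 0) w)"
      by (intro convergent_add convergent_const)
    then show ?case by simp
  qed
  define X where "X w = lim (\<lambda>k. \<xi> (g k) w)" for w
  have [measurable]: "X \<in> borel_measurable M" unfolding X_def by measurable
  have lim: "AE w in M. (\<lambda>k. \<xi> (g k) w) \<longlonglongrightarrow> X w"
    using conv unfolding X_def by eventually_elim (simp add: convergent_LIMSEQ_iff)
  have fatou: "(\<integral>\<^sup>+w. ennreal \<bar>X w - \<xi> h w\<bar> \<partial>M) \<le> ennreal (norm (v - S h))" for h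
  proof -
    have "(\<integral>\<^sup>+w. ennreal \<bar>X w - \<xi> h w\<bar> \<partial>M)
        = (\<integral>\<^sup>+w. liminf (\<lambda>k. ennreal \<bar>\<xi> (g k) w - \<xi> h w\<bar>) \<partial>M)"
    proof (rule nn_integral_cong_AE)
      show "AE w in M. ennreal \<bar>X w - \<xi> h w\<bar> = liminf (\<lambda>k. ennreal \<bar>\<xi> (g k) w - \<xi> h w\<bar>)"
        using lim
      proof eventually_elim
        case (elim w)
        then have "(\<lambda>k. ennreal \<bar>\<xi> (g k) w - \<xi> h w\<bar>) \<longlonglongrightarrow> ennreal \<bar>X w - \<xi> h w\<bar>"
          by (intro tendsto_intros)
        then show ?case by (intro lim_imp_Liminf[symmetric]) auto
      qed
    qed
    also have "\<dots> \<le> liminf (\<lambda>k. \<integral>\<^sup>+w. ennreal \<bar>\<xi> (g k) w - \<xi> h w\<bar> \<partial>M)"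
      by (rule nn_integral_liminf) simp
    also have "\<dots> \<le> liminf (\<lambda>k. ennreal (norm (v - S h) + (1/2)^k))"
    proof (intro Liminf_mono always_eventually allI)
      fix k
      have "(\<integral>\<^sup>+w. ennreal \<bar>\<xi> (g k) w - \<xi> h w\<bar> \<partial>M) = ennreal (\<integral>w. \<bar>\<xi> (g k) w - \<xi> h w\<bar> \<partial>M)"
        by (intro nn_integral_eq_integral integrable_abs Bochner_Integration.integrable_diff
            noise_integrable) simp
      also have "(\<integral>w. \<bar>\<xi> (g k) w - \<xi> h w\<bar> \<partial>M) \<le> norm (S (g k) - S h)" by (rule noise_diff_abs)
      also have "\<dots> \<le> norm (v - S h) + (1/2)^k"
        using norm_triangle_ineq4[of "v - S h" "v - S (g k)"] g[of k] by simp
      finally show "(\<integral>\<^sup>+w. ennreal \<bar>\<xi> (g k) w - \<xi> h w\<bar> \<partial>M) \<le> ennreal (norm (v - S h) + (1/2)^k)"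
        by (simp add: ennreal_leI)
    qed
    also have "\<dots> = ennreal (norm (v - S h))"
    proof (rule lim_imp_Liminf)
      have "(\<lambda>k. norm (v - S h) + (1/2)^k) \<longlonglongrightarrow> norm (v - S h) + 0"
        by (intro tendsto_intros LIMSEQ_realpow_zero) auto
      then show "(\<lambda>k. ennreal (norm (v - S h) + (1/2)^k)) \<longlonglongrightarrow> ennreal (norm (v - S h))"
        by (intro tendsto_ennrealI) simp
    qed simp
    finally show ?thesis .
  qed
  have int: "integrable M (\<lambda>w. X w - \<xi> h w)" for h
    by (rule integrableI_bounded) (use fatou[of h] in \<open>auto simp: less_top[symmetric] top_unique\<close>)
  have "integrable M (\<lambda>w. (X w - \<xi> 0 w) + \<xi> 0 w)"
    by (intro Bochner_Integration.integrable_add int noise_integrable)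
  then have "integrable M X" by simp
  moreover have "(\<integral>w. \<bar>X w - \<xi> h w\<bar> \<partial>M) \<le> norm (v - S h)" for h
    using fatou[of h] int[of h] by (simp add: nn_integral_eq_integral)
  ultimately show ?thesis by blast
qed

text \<open>
  The isonormal field: a centred Gaussian field with covariance \<open>u \<bullet> v\<close> such that \<open>W (S h) = \<xi> h\<close>
  almost surely.  The estimate determines \<open>W v\<close> up to a null set, because the range of \<open>S\<close> is dense; all
  properties below follow from it by approximation of \<open>v\<close> from this range.
\<close>

definition W :: "'h \<Rightarrow> 'w \<Rightarrow> real" where
  "W v = (SOME X. integrable M X \<and> (\<forall>h. (\<integral>w. \<bar>X w - \<xi> h w\<bar> \<partial>M) \<le> norm (v - S h)))"

lemma W_integrable: "integrable M (W v)"
  and W_approx: "(\<integral>w. \<bar>W v w - \<xi> h w\<bar> \<partial>M) \<le> norm (v - S h)"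
  using someI_ex[OF isonormal_extension[of v]] by (auto simp: W_def)

lemma W_measurable [measurable]: "W v \<in> borel_measurable M"
  using W_integrable by auto

lemma approximate_by_range: "0 < e \<Longrightarrow> \<exists>h. norm (v - S h) < e"
  using closure_approachable[of v "range S"] dense_S by (auto simp: dist_norm norm_minus_commute)

lemma W_range: "AE w in M. W (S h) w = \<xi> h w"
proof -
  have "(\<integral>w. \<bar>W (S h) w - \<xi> h w\<bar> \<partial>M) = 0"
    by (intro antisym Bochner_Integration.integral_nonneg) (use W_approx[of "S h" h] in simp_all)
  then show ?thesis
    using integral_nonneg_eq_0_iff_AE[of M "\<lambda>w. \<bar>W (S h) w - \<xi> h w\<bar>"] W_integrable noise_integrable
    by simp
qed

lemma W_linear: "AE w in M. W (a *\<^sub>R u + b *\<^sub>R v) w = a * W u w + b * W v w"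
proof -
  let ?D = "\<lambda>w. \<bar>W (a *\<^sub>R u + b *\<^sub>R v) w - (a * W u w + b * W v w)\<bar>"
  have int: "integrable M ?D"
    by (intro integrable_abs Bochner_Integration.integrable_diff Bochner_Integration.integrable_add
        integrable_mult_right W_integrable)
  have "(\<integral>w. ?D w \<partial>M) \<le> 0"
  proof (rule field_le_epsilon)
    fix e :: real assume "0 < e"
    define c where "c = e / (2 * (\<bar>a\<bar> + \<bar>b\<bar> + 1))"
    have c: "0 < c" "2 * (\<bar>a\<bar> + \<bar>b\<bar>) * c \<le> e"
      using \<open>0 < e\<close> by (auto simp: c_def field_simps)
    obtain g where g: "norm (u - S g) < c" using approximate_by_range[OF c(1)] by blast
    obtain h where h: "norm (v - S h) < c" using approximate_by_range[OF c(1)] by blast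
    let ?g = "a *\<^sub>R g + b *\<^sub>R h"
    let ?R = "\<lambda>w. \<bar>W (a *\<^sub>R u + b *\<^sub>R v) w - \<xi> ?g w\<bar> + (\<bar>a\<bar> * \<bar>W u w - \<xi> g w\<bar> + \<bar>b\<bar> * \<bar>W v w - \<xi> h w\<bar>)"
    have intR: "integrable M (\<lambda>w. \<bar>W (a *\<^sub>R u + b *\<^sub>R v) w - \<xi> ?g w\<bar>)"
      "integrable M (\<lambda>w. \<bar>W u w - \<xi> g w\<bar>)" "integrable M (\<lambda>w. \<bar>W v w - \<xi> h w\<bar>)"
      by (intro integrable_abs Bochner_Integration.integrable_diff W_integrable noise_integrable)+
    have "(\<integral>w. ?D w \<partial>M) \<le> (\<integral>w. ?R w \<partial>M)"
    proof (rule integral_mono_AE)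
      show "AE w in M. ?D w \<le> ?R w"
        using noise_linear[of a g b h]
      proof eventually_elim
        case (elim w)
        let ?P = "W (a *\<^sub>R u + b *\<^sub>R v) w - \<xi> ?g w" and ?Q = "a * (W u w - \<xi> g w) + b * (W v w - \<xi> h w)"
        have "W (a *\<^sub>R u + b *\<^sub>R v) w - (a * W u w + b * W v w) = ?P - ?Q"
          by (simp add: elim algebra_simps)
        then have "?D w \<le> \<bar>?P\<bar> + \<bar>?Q\<bar>"
          using abs_triangle_ineq4[of ?P ?Q] by simp
        also have "\<bar>?Q\<bar> \<le> \<bar>a\<bar> * \<bar>W u w - \<xi> g w\<bar> + \<bar>b\<bar> * \<bar>W v w - \<xi> h w\<bar>"
          unfolding abs_mult[symmetric] by (rule abs_triangle_ineq)
        finally show ?case by simp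
      qed
    qed (use int intR in auto)
    also have "\<dots> = (\<integral>w. \<bar>W (a *\<^sub>R u + b *\<^sub>R v) w - \<xi> ?g w\<bar> \<partial>M)
        + (\<bar>a\<bar> * (\<integral>w. \<bar>W u w - \<xi> g w\<bar> \<partial>M) + \<bar>b\<bar> * (\<integral>w. \<bar>W v w - \<xi> h w\<bar> \<partial>M))"
      using intR by simp
    also have "\<dots> \<le> norm (a *\<^sub>R u + b *\<^sub>R v - S ?g) + (\<bar>a\<bar> * norm (u - S g) + \<bar>b\<bar> * norm (v - S h))"
      by (intro add_mono mult_left_mono W_approx) auto
    also have "a *\<^sub>R u + b *\<^sub>R v - S ?g = a *\<^sub>R (u - S g) + b *\<^sub>R (v - S h)"
      by (simp add: S.add S.scaleR algebra_simps)
    also have "norm \<dots> \<le> \<bar>a\<bar> * norm (u - S g) + \<bar>b\<bar> * norm (v - S h)"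
      using norm_triangle_ineq[of "a *\<^sub>R (u - S g)" "b *\<^sub>R (v - S h)"] by simp
    finally have "(\<integral>w. ?D w \<partial>M) \<le> 2 * (\<bar>a\<bar> * norm (u - S g) + \<bar>b\<bar> * norm (v - S h))" by simp
    also have "\<dots> \<le> 2 * (\<bar>a\<bar> * c + \<bar>b\<bar> * c)"
      using g h by (intro mult_left_mono add_mono) auto
    also have "\<dots> \<le> e" using c(2) by (simp add: algebra_simps)
    finally show "(\<integral>w. ?D w \<partial>M) \<le> 0 + e" by simp
  qed
  then have "(\<integral>w. ?D w \<partial>M) = 0" by (intro antisym Bochner_Integration.integral_nonneg) auto
  then show ?thesis using integral_nonneg_eq_0_iff_AE[OF int] by simp
qed

text \<open>
  Passage to the limit along \<open>S (h k) \<longlonglongrightarrow> v\<close>, where the difference of the cosines is bounded in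
  mean by \<open>\<bar>t\<bar> * norm (v - S (h k))\<close>.
\<close>

lemma W_cos: "(\<integral>w. cos (t * W v w + a) \<partial>M) = cos a * exp (- (t * norm v)\<^sup>2 / 2)"
proof -
  have "\<exists>h. norm (v - S h) < inverse (real (Suc k))" for k
    by (rule approximate_by_range) simp
  then obtain h where h: "\<And>k. norm (v - S (h k)) < inverse (real (Suc k))" by metis
  have h0: "(\<lambda>k. norm (v - S (h k))) \<longlonglongrightarrow> 0"
    by (rule tendsto_sandwich[OF _ _ tendsto_const LIMSEQ_inverse_real_of_nat])
      (use h in \<open>auto simp del: of_nat_Suc intro!: always_eventually less_imp_le\<close>)
  have int: "integrable M (\<lambda>w. cos (f w))" if [measurable]: "f \<in> borel_measurable M" for f :: "'w \<Rightarrow> real"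
    by (rule integrable_const_bound[where B = 1]) auto
  have "(\<lambda>k. (\<integral>w. cos (t * \<xi> (h k) w + a) \<partial>M) - (\<integral>w. cos (t * W v w + a) \<partial>M)) \<longlonglongrightarrow> 0"
  proof (rule Lim_null_comparison)
    show "(\<lambda>k. \<bar>t\<bar> * norm (v - S (h k))) \<longlonglongrightarrow> 0" using tendsto_mult_left[OF h0, of "\<bar>t\<bar>"] by simp
    show "\<forall>\<^sub>F k in sequentially. norm ((\<integral>w. cos (t * \<xi> (h k) w + a) \<partial>M) - (\<integral>w. cos (t * W v w + a) \<partial>M))
        \<le> \<bar>t\<bar> * norm (v - S (h k))"
    proof (intro always_eventually allI)
      fix k
      have "norm ((\<integral>w. cos (t * \<xi> (h k) w + a) \<partial>M) - (\<integral>w. cos (t * W v w + a) \<partial>M))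
          = \<bar>\<integral>w. cos (t * \<xi> (h k) w + a) - cos (t * W v w + a) \<partial>M\<bar>"
        by (simp add: int)
      also have "\<dots> \<le> (\<integral>w. \<bar>cos (t * \<xi> (h k) w + a) - cos (t * W v w + a)\<bar> \<partial>M)"
        by (rule integral_abs_bound)
      also have "\<dots> \<le> (\<integral>w. \<bar>t\<bar> * \<bar>W v w - \<xi> (h k) w\<bar> \<partial>M)"
      proof (rule integral_mono)
        fix w
        show "\<bar>cos (t * \<xi> (h k) w + a) - cos (t * W v w + a)\<bar> \<le> \<bar>t\<bar> * \<bar>W v w - \<xi> (h k) w\<bar>"
          using abs_cos_diff[of "t * \<xi> (h k) w + a" "t * W v w + a"]
          by (simp add: right_diff_distrib[symmetric] abs_mult abs_minus_commute)
      qed (intro integrable_abs Bochner_Integration.integrable_diff integrable_mult_right int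
            W_integrable noise_integrable; simp)+
      also have "\<dots> \<le> \<bar>t\<bar> * norm (v - S (h k))" by (simp add: mult_left_mono W_approx)
      finally show "norm ((\<integral>w. cos (t * \<xi> (h k) w + a) \<partial>M) - (\<integral>w. cos (t * W v w + a) \<partial>M))
          \<le> \<bar>t\<bar> * norm (v - S (h k))" .
    qed
  qed
  then have "(\<lambda>k. \<integral>w. cos (t * \<xi> (h k) w + a) \<partial>M) \<longlonglongrightarrow> (\<integral>w. cos (t * W v w + a) \<partial>M)"
    by (rule LIM_zero_cancel)
  moreover have "(\<lambda>k. \<integral>w. cos (t * \<xi> (h k) w + a) \<partial>M) \<longlonglongrightarrow> cos a * exp (- (t * norm v)\<^sup>2 / 2)"
  proof -
    have "(\<lambda>k. v - (v - S (h k))) \<longlonglongrightarrow> v - 0"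
      by (intro tendsto_intros) (use h0 in \<open>simp add: tendsto_norm_zero_iff\<close>)
    then have "(\<lambda>k. S (h k)) \<longlonglongrightarrow> v" by simp
    then show ?thesis unfolding noise_cos by (intro tendsto_intros) auto
  qed
  ultimately show ?thesis by (rule LIMSEQ_unique)
qed

lemma W_law: "distr M borel (W v) = distr std_normal_distribution borel (\<lambda>x. norm v * x)"
proof (rule finite_real_measure_eqI_cos)
  interpret N: real_distribution std_normal_distribution by (rule real_dist_normal_dist)
  show "finite_measure (distr M borel (W v))" by (rule finite_measure_distr) simp
  show "finite_measure (distr std_normal_distribution borel (\<lambda>x. norm v * x))"
    by (rule N.finite_measure_distr) simp
  show "(\<integral>x. cos (t * x + b) \<partial>distr M borel (W v))
      = (\<integral>x. cos (t * x + b) \<partial>distr std_normal_distribution borel (\<lambda>x. norm v * x))" for t b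
    using integral_std_normal_cos[of "t * norm v" b]
    by (simp add: integral_distr W_cos mult.assoc)
qed simp_all

subsection \<open>The Cameron--Martin formula\<close>

lemma W_exponential_tilt:
  assumes [measurable]: "f \<in> borel_measurable borel"
  shows "(\<integral>w. exp (W v w) * f (W v w) \<partial>M)
       = exp ((norm v)\<^sup>2 / 2) * (\<integral>x. f ((norm v)\<^sup>2 + norm v * x) \<partial>std_normal_distribution)"
proof -
  have "(\<integral>w. exp (W v w) * f (W v w) \<partial>M)
      = (\<integral>x. exp (norm v * x) * f (norm v * x) \<partial>std_normal_distribution)"
    by (rule law_integral(1)[OF W_measurable W_law, of "\<lambda>x. exp x * f x"]) simp
  also have "\<dots> = exp ((norm v)\<^sup>2 / 2) * (\<integral>x. f (norm v * (norm v + x)) \<partial>std_normal_distribution)"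
    by (rule std_normal_exponential_tilt[of "\<lambda>x. f (norm v * x)"]) simp
  finally show ?thesis by (simp add: distrib_left power2_eq_square)
qed

lemma W_exp: "(\<integral>w. exp (W v w) \<partial>M) = exp ((norm v)\<^sup>2 / 2)"
proof -
  interpret N: real_distribution std_normal_distribution by (rule real_dist_normal_dist)
  show ?thesis using W_exponential_tilt[of "\<lambda>_. 1" v] N.prob_space by simp
qed

lemma W_exp_integrable: "integrable M (\<lambda>w. exp (W v w))"
  using W_exp[of v] not_integrable_integral_eq[of M "\<lambda>w. exp (W v w)"] by fastforce

lemma W_exp_cos:
  "(\<integral>w. exp (W v w) * cos (c * W v w + a) \<partial>M)
     = exp ((norm v)\<^sup>2 / 2) * (cos (c * (norm v)\<^sup>2 + a) * exp (- (c * norm v)\<^sup>2 / 2))"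
  using W_exponential_tilt[of "\<lambda>x. cos (c * x + a)" v]
    integral_std_normal_cos[of "c * norm v" "c * (norm v)\<^sup>2 + a"]
  by (simp add: algebra_simps)

text \<open>
  Orthogonal vectors give independent variables.  Here the one-dimensional uniqueness theorem is
  applied to the law of \<open>W v\<close> under the weight \<open>2 + cos (W z + a)\<close> and under a constant weight.
\<close>

lemma W_orthogonal_cos:
  assumes orth: "z \<bullet> v = 0" and [measurable]: "f \<in> borel_measurable borel"
    and int: "integrable M (\<lambda>w. f (W v w))"
  shows "(\<integral>w. cos (W z w + a) * f (W v w) \<partial>M)
       = cos a * exp (- (norm z)\<^sup>2 / 2) * (\<integral>w. f (W v w) \<partial>M)"
proof -
  define C where "C = cos a * exp (- (norm z)\<^sup>2 / 2)"
  have icos: "integrable M (\<lambda>w. cos (g w))" if [measurable]: "g \<in> borel_measurable M" for g :: "'w \<Rightarrow> real"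
    by (rule integrable_const_bound[where B = 1]) auto
  have iprod: "integrable M (\<lambda>w. cos (W z w + a) * f (W v w))"
    by (rule Bochner_Integration.integrable_bound[OF int]) (auto simp: abs_mult mult_left_le_one_le)
  have "\<bar>C\<bar> \<le> 1" unfolding C_def by (simp add: abs_mult mult_le_one)
  have sum: "(\<integral>w. cos (W z w + s * W v w + d) \<partial>M)
      = cos d * exp (- (norm z)\<^sup>2 / 2) * exp (- (s * norm v)\<^sup>2 / 2)" for s d
  proof -
    have "(\<integral>w. cos (W z w + s * W v w + d) \<partial>M) = (\<integral>w. cos (1 * W (z + s *\<^sub>R v) w + d) \<partial>M)"
      by (rule integral_cong_AE) (use W_linear[of 1 z s v] in auto)
    also have "\<dots> = cos d * exp (- (norm (z + s *\<^sub>R v))\<^sup>2 / 2)" unfolding W_cos by simp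
    also have "(norm (z + s *\<^sub>R v))\<^sup>2 = (norm z)\<^sup>2 + (s * norm v)\<^sup>2"
      using orth by (simp add: power2_norm_eq_inner power_mult_distrib inner_simps inner_commute
          power2_eq_square[of s] algebra_simps)
    also have "exp (- ((norm z)\<^sup>2 + (s * norm v)\<^sup>2) / 2)
        = exp (- (norm z)\<^sup>2 / 2) * exp (- (s * norm v)\<^sup>2 / 2)"
      by (simp add: exp_add[symmetric] field_simps)
    finally show ?thesis by simp
  qed
  have "(\<integral>w. (2 + cos (W z w + a)) * f (W v w) \<partial>M) = (\<integral>w. (2 + C) * f (W v w) \<partial>M)"
  proof (rule weighted_integral_eqI_cos[where X = "W v" and Y = "W v" and f = f
        and w = "\<lambda>w. 2 + cos (W z w + a)" and v = "\<lambda>_. 2 + C"])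
    show "0 \<le> 2 + cos (W z w + a)" for w using cos_ge_minus_one[of "W z w + a"] by linarith
    show "0 \<le> 2 + C" using \<open>\<bar>C\<bar> \<le> 1\<close> by simp
    show "(\<integral>w. (2 + cos (W z w + a)) * cos (t * W v w + b) \<partial>M)
        = (\<integral>w. (2 + C) * cos (t * W v w + b) \<partial>M)" for t b
    proof -
      have "(2 + cos (W z w + a)) * cos (t * W v w + b) = 2 * cos (t * W v w + b)
          + (cos (W z w + (- t) * W v w + (a - b)) + cos (W z w + t * W v w + (a + b))) / 2" for w
        by (simp only: distrib_right cos_times_cos) (simp add: algebra_simps)
      then have "(\<integral>w. (2 + cos (W z w + a)) * cos (t * W v w + b) \<partial>M)
          = 2 * (\<integral>w. cos (t * W v w + b) \<partial>M)
            + ((\<integral>w. cos (W z w + (- t) * W v w + (a - b)) \<partial>M)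
             + (\<integral>w. cos (W z w + t * W v w + (a + b)) \<partial>M)) / 2"
        by (simp add: icos)
      also have "\<dots> = 2 * (cos b * exp (- (t * norm v)\<^sup>2 / 2))
            + (cos (a - b) + cos (a + b)) / 2 * exp (- (norm z)\<^sup>2 / 2) * exp (- (t * norm v)\<^sup>2 / 2)"
        unfolding sum W_cos by (simp add: field_simps)
      also have "(cos (a - b) + cos (a + b)) / 2 = cos a * cos b"
        by (simp add: cos_times_cos)
      also have "2 * (cos b * exp (- (t * norm v)\<^sup>2 / 2))
            + cos a * cos b * exp (- (norm z)\<^sup>2 / 2) * exp (- (t * norm v)\<^sup>2 / 2)
          = (2 + C) * (cos b * exp (- (t * norm v)\<^sup>2 / 2))"
        by (simp add: C_def algebra_simps)
      also have "\<dots> = (\<integral>w. (2 + C) * cos (t * W v w + b) \<partial>M)" by (simp add: W_cos)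
      finally show ?thesis .
    qed
  qed (auto intro!: icos)
  then have "2 * (\<integral>w. f (W v w) \<partial>M) + (\<integral>w. cos (W z w + a) * f (W v w) \<partial>M)
      = (2 + C) * (\<integral>w. f (W v w) \<partial>M)"
    using int iprod by (simp add: distrib_right)
  then show ?thesis by (simp add: C_def algebra_simps)
qed

text \<open>
  Split \<open>u\<close> into a multiple of \<open>v\<close> and a vector \<open>z\<close> orthogonal to \<open>v\<close>.  The variable \<open>W z\<close> is
  independent of \<open>W v\<close> and contributes the factor \<open>exp (- (norm z)\<^sup>2 / 2)\<close>; what remains is an integral
  over the one-dimensional law of \<open>W v\<close>, tilted exponentially.
\<close>

lemma cameron_martin_cos:
  "(\<integral>w. exp (W v w) * cos (W u w + a) \<partial>M)
     = exp ((norm v)\<^sup>2 / 2) * (cos (u \<bullet> v + a) * exp (- (norm u)\<^sup>2 / 2))"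
proof -
  \<comment> \<open>For \<open>v = 0\<close> this is \<open>0\<close> by the convention for division, and \<open>z = u\<close> is still orthogonal to \<open>v\<close>.\<close>
  define c where "c = (u \<bullet> v) / (norm v)\<^sup>2"
  define z where "z = u - c *\<^sub>R v"
  have cv: "c * (norm v)\<^sup>2 = u \<bullet> v" by (cases "v = 0") (simp_all add: c_def)
  have orth: "z \<bullet> v = 0"
    using cv by (simp add: z_def inner_diff_left power2_norm_eq_inner)
  have "u = z + c *\<^sub>R v" by (simp add: z_def)
  then have norm_u: "(norm u)\<^sup>2 = (norm z)\<^sup>2 + (c * norm v)\<^sup>2"
    using orth by (simp add: power2_norm_eq_inner power_mult_distrib inner_simps inner_commute
        power2_eq_square[of c] algebra_simps)
  have bound: "integrable M (\<lambda>w. exp (W v w) * g w)"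
    if "g \<in> borel_measurable M" "\<And>w. \<bar>g w\<bar> \<le> 1" for g :: "'w \<Rightarrow> real"
    by (rule Bochner_Integration.integrable_bound[OF W_exp_integrable[of v]])
      (use that in \<open>auto simp: abs_mult mult_left_le\<close>)
  have i1: "integrable M (\<lambda>w. exp (W v w) * cos (c * W v w))"
    and i2: "integrable M (\<lambda>w. exp (W v w) * sin (c * W v w))"
    by (rule bound; simp)+
  have i3: "integrable M (\<lambda>w. cos (W z w + d) * (exp (W v w) * cos (c * W v w)))"
    and i4: "integrable M (\<lambda>w. cos (W z w + d) * (exp (W v w) * sin (c * W v w)))" for d
    by (rule Bochner_Integration.integrable_bound[OF i1] Bochner_Integration.integrable_bound[OF i2],
        simp, simp add: abs_mult mult_left_le_one_le)+
  have "(\<integral>w. exp (W v w) * cos (W u w + a) \<partial>M)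
      = (\<integral>w. cos (W z w + a) * (exp (W v w) * cos (c * W v w))
            - cos (W z w + (a - pi / 2)) * (exp (W v w) * sin (c * W v w)) \<partial>M)"
  proof (rule integral_cong_AE)
    show "AE w in M. exp (W v w) * cos (W u w + a)
        = cos (W z w + a) * (exp (W v w) * cos (c * W v w))
          - cos (W z w + (a - pi / 2)) * (exp (W v w) * sin (c * W v w))"
      using W_linear[of 1 z c v]
    proof eventually_elim
      case (elim w)
      have "W u w + a = (W z w + a) + c * W v w" using elim \<open>u = z + c *\<^sub>R v\<close> by simp
      moreover have "cos (W z w + (a - pi / 2)) = sin (W z w + a)"
        using cos_diff[of "W z w + a" "pi / 2"] by (simp add: add_diff_eq)
      ultimately show ?case by (simp only: cos_add[of "W z w + a"]) (simp add: algebra_simps)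
    qed
  qed auto
  also have "\<dots> = cos a * exp (- (norm z)\<^sup>2 / 2) * (\<integral>w. exp (W v w) * cos (c * W v w) \<partial>M)
      - cos (a - pi / 2) * exp (- (norm z)\<^sup>2 / 2) * (\<integral>w. exp (W v w) * sin (c * W v w) \<partial>M)"
    using W_orthogonal_cos[OF orth _ i1, of a] W_orthogonal_cos[OF orth _ i2, of "a - pi / 2"] i3 i4
    by simp
  also have "\<dots> = exp (- (norm z)\<^sup>2 / 2) * (\<integral>w. exp (W v w) * cos (c * W v w + a) \<partial>M)"
  proof -
    have "exp (W v w) * cos (c * W v w + a)
        = cos a * (exp (W v w) * cos (c * W v w)) - sin a * (exp (W v w) * sin (c * W v w))" for w
      by (simp add: cos_add algebra_simps)
    then have "(\<integral>w. exp (W v w) * cos (c * W v w + a) \<partial>M)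
        = cos a * (\<integral>w. exp (W v w) * cos (c * W v w) \<partial>M)
          - sin a * (\<integral>w. exp (W v w) * sin (c * W v w) \<partial>M)"
      using i1 i2 by simp
    moreover have "cos (a - pi / 2) = sin a" by (simp add: cos_diff)
    ultimately show ?thesis by (simp only: right_diff_distrib mult_ac)
  qed
  also have "\<dots> = exp ((norm v)\<^sup>2 / 2) * (cos (u \<bullet> v + a)
      * (exp (- (norm z)\<^sup>2 / 2) * exp (- (c * norm v)\<^sup>2 / 2)))"
    by (simp add: W_exp_cos cv)
  also have "exp (- (norm z)\<^sup>2 / 2) * exp (- (c * norm v)\<^sup>2 / 2) = exp (- (norm u)\<^sup>2 / 2)"
    unfolding norm_u by (simp add: exp_add[symmetric] field_simps)
  finally show ?thesis .
qed

definition likelihood_ratio :: "'h \<Rightarrow> 'w \<Rightarrow> real" where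
  "likelihood_ratio v w = exp (W v w - (norm v)\<^sup>2 / 2)"

lemma likelihood_ratio_measurable [measurable]: "likelihood_ratio v \<in> borel_measurable M"
  unfolding likelihood_ratio_def by measurable

lemma likelihood_ratio_integrable: "integrable M (likelihood_ratio v)"
  using W_exp_integrable[of v] by (simp add: likelihood_ratio_def[abs_def] exp_diff)

lemma likelihood_ratio_integral: "(\<integral>w. likelihood_ratio v w \<partial>M) = 1"
  using W_exp[of v] by (simp add: likelihood_ratio_def exp_diff)

lemma likelihood_ratio_mult:
  shows "integrable M (\<lambda>w. likelihood_ratio u w * likelihood_ratio v w)"
    and "(\<integral>w. likelihood_ratio u w * likelihood_ratio v w \<partial>M) = exp (u \<bullet> v)"
proof -
  have eq: "AE w in M. likelihood_ratio u w * likelihood_ratio v w = exp (u \<bullet> v) * likelihood_ratio (u + v) w"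
    using W_linear[of 1 u 1 v]
  proof eventually_elim
    case (elim w)
    have "(norm (u + v))\<^sup>2 / 2 = (norm u)\<^sup>2 / 2 + (norm v)\<^sup>2 / 2 + u \<bullet> v"
      by (simp add: power2_norm_eq_inner inner_simps inner_commute)
    moreover have "W (u + v) w = W u w + W v w" using elim by simp
    ultimately have "(W u w - (norm u)\<^sup>2 / 2) + (W v w - (norm v)\<^sup>2 / 2)
        = u \<bullet> v + (W (u + v) w - (norm (u + v))\<^sup>2 / 2)" by linarith
    then show ?case by (simp only: likelihood_ratio_def exp_add[symmetric])
  qed
  have int: "integrable M (\<lambda>w. exp (u \<bullet> v) * likelihood_ratio (u + v) w)"
    by (intro integrable_mult_right likelihood_ratio_integrable)
  show "integrable M (\<lambda>w. likelihood_ratio u w * likelihood_ratio v w)"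
    by (rule integrable_cong_AE_imp[OF int]) (use eq in \<open>auto elim: eventually_mono\<close>)
  have "(\<integral>w. likelihood_ratio u w * likelihood_ratio v w \<partial>M) = (\<integral>w. exp (u \<bullet> v) * likelihood_ratio (u + v) w \<partial>M)"
    by (rule integral_cong_AE) (use eq in auto)
  then show "(\<integral>w. likelihood_ratio u w * likelihood_ratio v w \<partial>M) = exp (u \<bullet> v)" by (simp add: likelihood_ratio_integral)
qed

text \<open>
  A linear form in the coordinates is almost surely the noise at a single vector \<open>h\<close>, so both sides
  are compared on cosines of \<open>W (S (e *\<^sub>R h))\<close>.  There the shift turns into the phase
  \<open>e * (v \<bullet> S h)\<close>, which is what the exponential tilt produces.
\<close>

theorem cameron_martin:
  assumes K: "K \<in> borel_measurable (PiM UNIV (\<lambda>_. borel))"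
  shows "(\<integral>w. K (\<lambda>h. e * (v \<bullet> S h + \<xi> h w)) \<partial>M) = (\<integral>w. likelihood_ratio v w * K (\<lambda>h. e * \<xi> h w) \<partial>M :: real)"
proof (rule likelihood_ratioI_cos[OF _ _ K likelihood_ratio_integrable])
  show "0 \<le> likelihood_ratio v w" for w by (simp add: likelihood_ratio_def)
  fix xs :: "(real \<times> 'h) list" and a :: real
  define h where "h = (\<Sum>(t, j)\<leftarrow>xs. t *\<^sub>R j)"
  have noise_sum: "AE w in M. (\<Sum>(t, j)\<leftarrow>xs. t * (e * \<xi> j w)) = e * \<xi> h w"
    unfolding h_def
  proof (induction xs)
    case Nil
    show ?case using noise_linear[of 0 0 0 0] by eventually_elim simp
  next
    case (Cons p xs)
    obtain t j where p: "p = (t, j)" by (cases p)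
    show ?case using Cons noise_linear[of t j 1 "\<Sum>(t, j)\<leftarrow>xs. t *\<^sub>R j"]
      by eventually_elim (simp add: p algebra_simps)
  qed
  have mean_sum: "(\<Sum>(t, j)\<leftarrow>xs. t * (e * (v \<bullet> S j))) = e * (v \<bullet> S h)"
    unfolding h_def by (induction xs) (auto simp: S.zero S.add S.scaleR inner_add_right algebra_simps)
  have split: "(\<Sum>(t, j)\<leftarrow>xs. t * (e * (v \<bullet> S j + \<xi> j w)))
      = (\<Sum>(t, j)\<leftarrow>xs. t * (e * (v \<bullet> S j))) + (\<Sum>(t, j)\<leftarrow>xs. t * (e * \<xi> j w))" for w
    by (induction xs) (auto simp: algebra_simps)
  have [measurable]: "(\<lambda>w. \<Sum>(t, j)\<leftarrow>xs. t * (e * \<xi> j w)) \<in> borel_measurable M"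
    by (induction xs) auto
  have "(\<integral>w. cos ((\<Sum>(t, j)\<leftarrow>xs. t * (e * (v \<bullet> S j + \<xi> j w))) + a) \<partial>M)
      = (\<integral>w. cos (e * \<xi> h w + (e * (v \<bullet> S h) + a)) \<partial>M)"
    unfolding split mean_sum
    by (rule integral_cong_AE) (use noise_sum in \<open>auto elim!: eventually_mono simp: algebra_simps\<close>)
  also have "\<dots> = cos (e * (v \<bullet> S h) + a) * exp (- (e * norm (S h))\<^sup>2 / 2)" by (rule noise_cos)
  also have "\<dots> = (\<integral>w. likelihood_ratio v w * cos (W (S (e *\<^sub>R h)) w + a) \<partial>M)"
  proof -
    have "(\<integral>w. likelihood_ratio v w * cos (W (S (e *\<^sub>R h)) w + a) \<partial>M)
        = (\<integral>w. exp (W v w) * cos (W (S (e *\<^sub>R h)) w + a) \<partial>M) / exp ((norm v)\<^sup>2 / 2)"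
      by (simp add: likelihood_ratio_def exp_diff)
    then show ?thesis
      by (simp add: cameron_martin_cos S.scaleR inner_commute power_mult_distrib)
  qed
  also have "\<dots> = (\<integral>w. likelihood_ratio v w * cos ((\<Sum>(t, j)\<leftarrow>xs. t * (e * \<xi> j w)) + a) \<partial>M)"
  proof (rule integral_cong_AE)
    show "AE w in M. likelihood_ratio v w * cos (W (S (e *\<^sub>R h)) w + a)
        = likelihood_ratio v w * cos ((\<Sum>(t, j)\<leftarrow>xs. t * (e * \<xi> j w)) + a)"
      using noise_sum W_range[of "e *\<^sub>R h"] noise_linear[of e h 0 0]
      by eventually_elim simp
  qed auto
  finally show "(\<integral>w. cos ((\<Sum>(t, j)\<leftarrow>xs. t * (e * (v \<bullet> S j + \<xi> j w))) + a) \<partial>M)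
      = (\<integral>w. likelihood_ratio v w * cos ((\<Sum>(t, j)\<leftarrow>xs. t * (e * \<xi> j w)) + a) \<partial>M)" .
qed auto

subsection \<open>Mixtures over nearly orthogonal shifts\<close>

text \<open>
  Inside the square on the left stands the expectation of the test times the deviation \<open>D\<close> of the mean likelihood
  ratio from \<open>1\<close>, and the right-hand side bounds the variance of \<open>D\<close>, which is the mean of the numbers
  \<open>exp (v i \<bullet> v j) - 1\<close>.
\<close>

lemma mixture_of_shifts:
  fixes v :: "nat \<Rightarrow> 'h" and k :: nat
  assumes K: "K \<in> borel_measurable (PiM UNIV (\<lambda>_. borel))" "\<And>y. 0 \<le> K y" "\<And>y. K y \<le> 1"
    and "0 < k" and b: "\<And>i. i < k \<Longrightarrow> (norm (v i))\<^sup>2 \<le> b"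
    and \<eta>: "\<And>i j. i < k \<Longrightarrow> j < k \<Longrightarrow> i \<noteq> j \<Longrightarrow> v i \<bullet> v j \<le> \<eta>"
  shows "((\<Sum>i<k. \<integral>w. K (\<lambda>h. e * (v i \<bullet> S h + \<xi> h w)) \<partial>M) / k - (\<integral>w. K (\<lambda>h. e * \<xi> h w) \<partial>M))\<^sup>2
    \<le> exp b / k + (exp \<eta> - 1)"
proof -
  define D where "D w = (\<Sum>i<k. likelihood_ratio (v i) w) / k - 1" for w
  define \<kappa> where "\<kappa> w = K (\<lambda>h. e * \<xi> h w)" for w
  have [measurable]: "D \<in> borel_measurable M" unfolding D_def by measurable
  have [measurable]: "\<kappa> \<in> borel_measurable M"
    unfolding \<kappa>_def
    by (rule measurable_compose[OF _ K(1)]) (auto intro!: measurable_PiM_single' simp: space_PiM)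
  have \<kappa>01: "0 \<le> \<kappa> w" "\<kappa> w \<le> 1" for w using K(2,3) by (auto simp: \<kappa>_def)
  have int\<kappa>: "integrable M \<kappa>"
    by (rule integrable_const_bound[where B = 1]) (use \<kappa>01 in auto)
  have intl: "integrable M (\<lambda>w. likelihood_ratio u w * \<kappa> w)" for u
    by (rule Bochner_Integration.integrable_bound[OF likelihood_ratio_integrable[of u]])
      (use \<kappa>01 in \<open>auto simp: abs_mult mult_left_le\<close>)
  have intD: "integrable M D"
    unfolding D_def by (intro Bochner_Integration.integrable_diff integrable_divide_zero
        Bochner_Integration.integrable_sum likelihood_ratio_integrable impI) auto
  have sq: "(D w)\<^sup>2 = (\<Sum>i<k. \<Sum>j<k. likelihood_ratio (v i) w * likelihood_ratio (v j) w) / k\<^sup>2 - 2 * (\<Sum>i<k. likelihood_ratio (v i) w) / k + 1" for w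
    by (simp add: D_def power2_eq_square sum_product algebra_simps add_divide_distrib diff_divide_distrib)
  have intD2: "integrable M (\<lambda>w. (D w)\<^sup>2)"
    unfolding sq by (intro Bochner_Integration.integrable_diff Bochner_Integration.integrable_add
        integrable_divide_zero integrable_mult_right
        Bochner_Integration.integrable_sum likelihood_ratio_integrable likelihood_ratio_mult impI) auto
  have "(\<Sum>i<k. \<integral>w. K (\<lambda>h. e * (v i \<bullet> S h + \<xi> h w)) \<partial>M) / k - (\<integral>w. K (\<lambda>h. e * \<xi> h w) \<partial>M)
      = (\<Sum>i<k. \<integral>w. likelihood_ratio (v i) w * \<kappa> w \<partial>M) / k - (\<integral>w. \<kappa> w \<partial>M)"
    unfolding cameron_martin[OF K(1)] \<kappa>_def ..
  also have "\<dots> = (\<integral>w. D w * \<kappa> w \<partial>M)"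
    using intl int\<kappa> by (simp add: D_def left_diff_distrib sum_distrib_right sum_divide_distrib)
  finally have eq: "(\<Sum>i<k. \<integral>w. K (\<lambda>h. e * (v i \<bullet> S h + \<xi> h w)) \<partial>M) / k - (\<integral>w. K (\<lambda>h. e * \<xi> h w) \<partial>M)
      = (\<integral>w. D w * \<kappa> w \<partial>M)" .
  have "\<bar>\<integral>w. D w * \<kappa> w \<partial>M\<bar> \<le> (\<integral>w. \<bar>D w * \<kappa> w\<bar> \<partial>M)" by (rule integral_abs_bound)
  also have "\<dots> \<le> (\<integral>w. \<bar>D w\<bar> \<partial>M)"
  proof (rule integral_mono)
    show "integrable M (\<lambda>w. \<bar>D w * \<kappa> w\<bar>)"
      by (rule Bochner_Integration.integrable_bound[OF intD])
        (use \<kappa>01 in \<open>auto simp: abs_mult mult_left_le\<close>)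
  qed (use intD \<kappa>01 in \<open>auto simp: abs_mult mult_left_le\<close>)
  finally have "(\<integral>w. D w * \<kappa> w \<partial>M)\<^sup>2 \<le> (\<integral>w. \<bar>D w\<bar> \<partial>M)\<^sup>2"
    by (metis abs_ge_zero power2_abs power_mono)
  also have "\<dots> \<le> (\<integral>w. (D w)\<^sup>2 \<partial>M)"
    using variance_eq[of "\<lambda>w. \<bar>D w\<bar>"] variance_positive[of "\<lambda>w. \<bar>D w\<bar>"] intD intD2 by simp
  also have "\<dots> = (\<Sum>i<k. \<Sum>j<k. exp (v i \<bullet> v j)) / k\<^sup>2 - 1"
    unfolding sq using \<open>0 < k\<close> likelihood_ratio_mult likelihood_ratio_integrable
    by (simp add: likelihood_ratio_integral prob_space)
  also have "\<dots> \<le> (\<Sum>i<k. \<Sum>j<k. (if i = j then exp b else 0) + exp \<eta>) / k\<^sup>2 - 1"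
  proof (intro diff_right_mono divide_right_mono sum_mono)
    fix i j assume "i \<in> {..<k}" "j \<in> {..<k}"
    then show "exp (v i \<bullet> v j) \<le> (if i = j then exp b else 0) + exp \<eta>"
      using b[of i] \<eta>[of i j] by (auto simp: power2_norm_eq_inner intro: add_increasing2)
  qed simp
  also have "\<dots> = exp b / k + (exp \<eta> - 1)"
    using \<open>0 < k\<close> by (simp add: sum.distrib power2_eq_square field_simps)
  finally show ?thesis unfolding eq .
qed

end

section \<open>The observation model\<close>

text \<open>
  The variance of the coordinate at \<open>h\<close> is \<open>R h \<bullet> h = (norm (S h))\<^sup>2\<close>, and the kernel of \<open>S\<close> lies in
  that of \<open>R = S \<circ> S\<close>.
\<close>

lemma gaussian_field_of_covariance:
  fixes R :: "'h::{real_inner, complete_space} \<Rightarrow> 'h"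
  assumes M: "prob_space M" and vec: "gaussian_vector M \<xi>" and mean: "mean_zero M \<xi>"
    and cov: "covariance_operator M \<xi> R" and ker: "{x. R x = 0} = {0}"
  shows "gaussian_field M \<xi> (operator_sqrt R)"
proof -
  have R: "bounded_linear R" "R g \<bullet> h = (\<integral>w. \<xi> g w * \<xi> h w \<partial>M)" for g h
    using cov mean by (auto simp: covariance_operator_def mean_zero_def)
  have pos: "positive_operator R"
    unfolding positive_operator_def
    using R(1) by (auto simp: R(2) inner_commute[of _ "R _"] mult.commute)
  note S = operator_sqrt[OF pos]
  have norm_S: "(norm (operator_sqrt R h))\<^sup>2 = R h \<bullet> h" for h
    using positive_operatorD(2)[OF S(1), of h "operator_sqrt R h"]
    by (simp add: power2_norm_eq_inner S(2) inner_commute)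
  show ?thesis
  proof (intro gaussian_field.intro gaussian_field_axioms.intro M S(1))
    show "x = 0" if "operator_sqrt R x = 0" for x
    proof -
      interpret bounded_linear "operator_sqrt R" by (rule positive_operatorD(1)[OF S(1)])
      have "R x = 0" using S(2)[of x] that zero by simp
      then show ?thesis using ker by auto
    qed
    fix h
    have "gaussian_variable M (\<xi> h)" using vec by (simp add: gaussian_vector_def)
    then show "\<xi> h \<in> borel_measurable M" by (simp add: gaussian_variable_def)
    show "distr M borel (\<xi> h) = distr std_normal_distribution borel (\<lambda>x. norm (operator_sqrt R h) * x)"
      using mean
      by (intro gaussian_variable_law[OF M \<open>gaussian_variable M (\<xi> h)\<close>])
        (auto simp: mean_zero_def norm_S R(2))
  qed (use vec in \<open>auto simp: gaussian_vector_def\<close>)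
qed

context gaussian_field
begin

lemma observation_measurable [measurable]:
  "observation A \<xi> e \<theta> \<in> measurable M (PiM UNIV (\<lambda>_. borel))"
  unfolding observation_def[abs_def] by (auto intro!: measurable_PiM_single' simp: space_PiM)

lemma test_integrable:
  assumes "is_test K" shows "integrable M (\<lambda>w. K (observation A \<xi> e \<theta> w))"
proof -
  have [measurable]: "K \<in> borel_measurable (PiM UNIV (\<lambda>_. borel))"
    and "0 \<le> K y" "K y \<le> 1" for y
    using assms by (auto simp: is_test_def)
  then show ?thesis
    by (intro integrable_const_bound[where B = 1]) auto
qed

end

section \<open>Tests for relatively compact sets\<close>

definition rejects :: "'i set \<Rightarrow> ('i \<Rightarrow> real) \<Rightarrow> real" where
  "rejects F y = (if \<exists>h\<in>F. 1/2 \<le> \<bar>y h\<bar> then 1 else 0)"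

lemma rejects_is_test: "finite F \<Longrightarrow> is_test (rejects F)"
  unfolding is_test_def rejects_def[abs_def] by (auto intro!: measurable_If pred_intros_finite)

context gaussian_field
begin

text \<open>
  An error of either kind forces \<open>1/2 \<le> \<bar>e * \<xi> h\<bar>\<close> for some \<open>h \<in> F\<close>, so its
  indicator is at most the sum of the \<open>2 * \<bar>e * \<xi> h\<bar>\<close>.
\<close>

lemma rejects_errors:
  assumes F: "finite F" and "0 < e"
  shows "(\<integral>w. rejects F (\<lambda>h. e * \<xi> h w) \<partial>M) \<le> e * (\<Sum>h\<in>F. 2 * norm (S h))"
    and "h \<in> F \<Longrightarrow> 1 < \<bar>A \<theta> \<bullet> h\<bar> \<Longrightarrow>
      (\<integral>w. 1 - rejects F (observation A \<xi> e \<theta> w) \<partial>M) \<le> e * (\<Sum>h\<in>F. 2 * norm (S h))"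
proof -
  let ?s = "\<lambda>w. \<Sum>h\<in>F. 2 * (e * \<bar>\<xi> h w\<bar>)"
  have int: "integrable M ?s"
    by (intro Bochner_Integration.integrable_sum integrable_mult_right integrable_abs noise_integrable)
  have le: "(\<integral>w. ?s w \<partial>M) \<le> e * (\<Sum>h\<in>F. 2 * norm (S h))"
  proof -
    have "(\<integral>w. ?s w \<partial>M) = (\<Sum>h\<in>F. 2 * (e * (\<integral>w. \<bar>\<xi> h w\<bar> \<partial>M)))"
      using noise_integrable by simp
    also have "\<dots> \<le> (\<Sum>h\<in>F. 2 * (e * norm (S h)))"
      using \<open>0 < e\<close> by (intro sum_mono mult_left_mono noise_abs) auto
    finally show ?thesis by (simp add: sum_distrib_left mult_ac)
  qed
  have single: "2 * (e * \<bar>\<xi> h w\<bar>) \<le> ?s w" if "h \<in> F" for h w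
    using that F \<open>0 < e\<close> by (intro member_le_sum) auto
  have nonneg: "0 \<le> ?s w" for w using \<open>0 < e\<close> by (intro sum_nonneg) auto
  have "(\<integral>w. rejects F (\<lambda>h. e * \<xi> h w) \<partial>M) \<le> (\<integral>w. ?s w \<partial>M)"
  proof (rule integral_mono)
    show "integrable M (\<lambda>w. rejects F (\<lambda>h. e * \<xi> h w))"
      using test_integrable[OF rejects_is_test[OF F], of "\<lambda>_. 0" e 0] by (simp add: observation_def)
    show "rejects F (\<lambda>h. e * \<xi> h w) \<le> ?s w" for w
    proof (cases "\<exists>h\<in>F. 1/2 \<le> \<bar>e * \<xi> h w\<bar>")
      case True
      then obtain h where "h \<in> F" "1 \<le> 2 * (e * \<bar>\<xi> h w\<bar>)" using \<open>0 < e\<close> by (auto simp: abs_mult)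
      with single[of h w] show ?thesis by (simp add: rejects_def)
    qed (simp add: rejects_def nonneg)
  qed (rule int)
  with le show "(\<integral>w. rejects F (\<lambda>h. e * \<xi> h w) \<partial>M) \<le> e * (\<Sum>h\<in>F. 2 * norm (S h))" by simp
  assume h: "h \<in> F" "1 < \<bar>A \<theta> \<bullet> h\<bar>"
  have "(\<integral>w. 1 - rejects F (observation A \<xi> e \<theta> w) \<partial>M) \<le> (\<integral>w. ?s w \<partial>M)"
  proof (rule integral_mono)
    show "integrable M (\<lambda>w. 1 - rejects F (observation A \<xi> e \<theta> w))"
      by (rule Bochner_Integration.integrable_diff) (simp, intro test_integrable rejects_is_test F)
    show "1 - rejects F (observation A \<xi> e \<theta> w) \<le> ?s w" for w
    proof (cases "1/2 \<le> \<bar>A \<theta> \<bullet> h + e * \<xi> h w\<bar>")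
      case True
      then have "rejects F (observation A \<xi> e \<theta> w) = 1"
        using h(1) by (auto simp: rejects_def observation_def)
      then show ?thesis by (simp add: nonneg)
    next
      case False
      then have "1 \<le> 2 * \<bar>e * \<xi> h w\<bar>" using h(2) by linarith
      then have "1 \<le> ?s w" using single[OF h(1), of w] \<open>0 < e\<close> by (simp add: abs_mult)
      then show ?thesis by (simp add: rejects_def)
    qed
  qed (rule int)
  with le show "(\<integral>w. 1 - rejects F (observation A \<xi> e \<theta> w) \<partial>M) \<le> e * (\<Sum>h\<in>F. 2 * norm (S h))"
    by simp
qed

end

text \<open>
  For \<open>A \<theta> \<noteq> 0\<close> some multiple \<open>h\<close> of \<open>A \<theta>\<close> satisfies the inequality, which persists in a
  neighbourhood of \<open>\<theta>\<close>; compactness leaves finitely many \<open>h\<close>.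
\<close>

lemma separating_functionals:
  fixes A :: "'h::real_inner \<Rightarrow> 'h"
  assumes "compact C" and A: "bounded_linear A" and nz: "\<And>\<theta>. \<theta> \<in> C \<Longrightarrow> A \<theta> \<noteq> 0"
  obtains F where "finite F" "\<And>\<theta>. \<theta> \<in> C \<Longrightarrow> \<exists>h\<in>F. 1 < \<bar>A \<theta> \<bullet> h\<bar>"
proof -
  have "open {\<theta>. 1 < \<bar>A \<theta> \<bullet> h\<bar>}" for h
    by (intro open_Collect_less continuous_intros linear_continuous_on A)
  moreover have "C \<subseteq> (\<Union>h\<in>UNIV. {\<theta>. 1 < \<bar>A \<theta> \<bullet> h\<bar>})"
  proof
    fix \<theta> assume "\<theta> \<in> C"
    then have "0 < A \<theta> \<bullet> A \<theta>" using nz by simp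
    then have "1 < \<bar>A \<theta> \<bullet> ((2 / (A \<theta> \<bullet> A \<theta>)) *\<^sub>R A \<theta>)\<bar>" by simp
    then show "\<theta> \<in> (\<Union>h\<in>UNIV. {\<theta>. 1 < \<bar>A \<theta> \<bullet> h\<bar>})" by blast
  qed
  ultimately obtain F where "finite F" "C \<subseteq> (\<Union>h\<in>F. {\<theta>. 1 < \<bar>A \<theta> \<bullet> h\<bar>})"
    by (rule compactE_image[OF \<open>compact C\<close>])
  then show thesis using that by blast
qed

text \<open>
  Take for \<open>m n\<close> the largest \<open>k \<le> n\<close> such that \<open>\<bar>\<epsilon> i * C k\<bar> < 1 / (k + 1)\<close> for all \<open>i\<close> from some index
  \<open>N k \<le> n\<close> on, and \<open>0\<close> if there is none.
\<close>

lemma diagonal_index: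
  fixes \<epsilon> C :: "nat \<Rightarrow> real"
  assumes "\<epsilon> \<longlonglongrightarrow> 0"
  obtains m where "filterlim m at_top sequentially" "(\<lambda>n. \<epsilon> n * C (m n)) \<longlonglongrightarrow> 0"
proof -
  have "\<exists>N. \<forall>n\<ge>N. \<bar>\<epsilon> n * C k\<bar> < inverse (real (Suc k))" for k
  proof -
    have "(\<lambda>n. \<epsilon> n * C k) \<longlonglongrightarrow> 0" using tendsto_mult_right[OF assms, of "C k"] by simp
    from LIMSEQ_D[OF this, of "inverse (real (Suc k))"] show ?thesis by simp
  qed
  then obtain N where N: "\<And>k n. N k \<le> n \<Longrightarrow> \<bar>\<epsilon> n * C k\<bar> < inverse (real (Suc k))" by metis
  define m where "m n = Max {k. k \<le> n \<and> (k = 0 \<or> N k \<le> n)}" for n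
  have fin: "finite {k. k \<le> n \<and> (k = 0 \<or> N k \<le> n)}" for n by simp
  have m_mem: "m n \<in> {k. k \<le> n \<and> (k = 0 \<or> N k \<le> n)}" for n
    unfolding m_def by (rule Max_in[OF fin]) auto
  have m_ge: "k \<le> m n" if "k \<le> n" "N k \<le> n" for k n
    unfolding m_def by (rule Max_ge[OF fin]) (use that in auto)
  have lim: "filterlim m at_top sequentially"
    unfolding filterlim_at_top eventually_sequentially
  proof
    fix k
    show "\<exists>n0. \<forall>n\<ge>n0. k \<le> m n" using m_ge by (intro exI[of _ "max k (N k)"]) auto
  qed
  have "(\<lambda>n. \<epsilon> n * C (m n)) \<longlonglongrightarrow> 0"
  proof (rule Lim_null_comparison)
    show "(\<lambda>n. inverse (real (Suc (m n)))) \<longlonglongrightarrow> 0"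
      by (rule filterlim_compose[OF LIMSEQ_inverse_real_of_nat lim])
    have "\<forall>\<^sub>F n in sequentially. 1 \<le> m n" using lim by (simp add: filterlim_at_top)
    then show "\<forall>\<^sub>F n in sequentially. norm (\<epsilon> n * C (m n)) \<le> inverse (real (Suc (m n)))"
    proof eventually_elim
      case (elim n)
      then have "N (m n) \<le> n" using m_mem[of n] by auto
      from N[OF this] show ?case by simp
    qed
  qed
  with lim show thesis by (rule that)
qed

context gaussian_field
begin

text \<open>
  Rejecting at random with probability \<open>\<alpha>\<close> brings the level of a test with vanishing errors up to
  \<open>\<alpha>\<close>.
\<close>

lemma consistent_tests_of_compact:
  fixes A :: "'h \<Rightarrow> 'h"
  assumes A: "bounded_linear A" and ker: "{x. A x = 0} = {0}" and U: "compact (closure U)"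
    and \<epsilon>: "\<And>n. 0 < \<epsilon> n" "\<epsilon> \<longlonglongrightarrow> 0" and \<alpha>: "0 < \<alpha>" "\<alpha> < 1"
  obtains \<rho> K where "\<And>n. 0 < \<rho> n" "\<rho> \<longlonglongrightarrow> 0"
    "uniformly_consistent M (\<lambda>n. observation A \<xi> (\<epsilon> n)) \<alpha> K (\<lambda>n. {\<theta>. \<rho> n \<le> norm \<theta> \<and> \<theta> \<in> U})"
proof -
  interpret A: bounded_linear A by (rule A)
  have "\<exists>F. finite F \<and> (\<forall>\<theta>\<in>closure U. inverse (real (Suc k)) \<le> norm \<theta> \<longrightarrow> (\<exists>h\<in>F. 1 < \<bar>A \<theta> \<bullet> h\<bar>))" for k
  proof -
    let ?C = "closure U \<inter> {\<theta>. inverse (real (Suc k)) \<le> norm \<theta>}"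
    have "compact ?C"
      by (intro compact_Int_closed U closed_Collect_le continuous_intros)
    moreover have "A \<theta> \<noteq> 0" if "\<theta> \<in> ?C" for \<theta>
    proof
      assume "A \<theta> = 0"
      then have "\<theta> = 0" using ker by auto
      with that show False by simp
    qed
    ultimately obtain F where "finite F" "\<And>\<theta>. \<theta> \<in> ?C \<Longrightarrow> \<exists>h\<in>F. 1 < \<bar>A \<theta> \<bullet> h\<bar>"
      using separating_functionals[of ?C A] A by blast
    then show ?thesis by blast
  qed
  then obtain F where F: "\<And>k. finite (F k)"
    "\<And>k \<theta>. \<theta> \<in> closure U \<Longrightarrow> inverse (real (Suc k)) \<le> norm \<theta> \<Longrightarrow> \<exists>h\<in>F k. 1 < \<bar>A \<theta> \<bullet> h\<bar>"
    by metis
  define C where "C k = (\<Sum>h\<in>F k. 2 * norm (S h))" for k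
  obtain m where m: "filterlim m at_top sequentially" "(\<lambda>n. \<epsilon> n * C (m n)) \<longlonglongrightarrow> 0"
    by (rule diagonal_index[OF \<epsilon>(2)])
  define \<rho> where "\<rho> n = inverse (real (Suc (m n)))" for n
  define K where "K n y = \<alpha> + (1 - \<alpha>) * rejects (F (m n)) y" for n y
  have rej: "is_test (rejects (F (m n)))" for n by (rule rejects_is_test[OF F(1)])
  have rej01: "0 \<le> rejects (F (m n)) y" "rejects (F (m n)) y \<le> 1" for n y
    by (auto simp: rejects_def)
  have intrej: "integrable M (\<lambda>w. rejects (F (m n)) (observation A \<xi> e \<theta> w))" for n e \<theta>
    by (rule test_integrable[OF rej])
  have C0: "0 \<le> \<epsilon> n * C (m n)" for n
    using \<epsilon>(1)[of n] by (auto simp: C_def intro!: mult_nonneg_nonneg sum_nonneg)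
  have test: "is_test (K n)" for n
    unfolding is_test_def
  proof (intro conjI allI)
    have [measurable]: "rejects (F (m n)) \<in> borel_measurable (PiM UNIV (\<lambda>_. borel))"
      using rej[of n] by (simp add: is_test_def)
    show "K n \<in> borel_measurable (PiM UNIV (\<lambda>_. borel))"
      unfolding K_def[abs_def] by measurable
    fix y
    show "0 \<le> K n y" using rej01[of n y] \<alpha> by (simp add: K_def)
    have "(1 - \<alpha>) * rejects (F (m n)) y \<le> 1 - \<alpha>" using rej01 \<alpha> by (intro mult_left_le) auto
    then show "K n y \<le> 1" by (simp add: K_def)
  qed
  have typeI: "\<bar>type_I_error M (observation A \<xi> (\<epsilon> n)) (K n) - \<alpha>\<bar> \<le> \<epsilon> n * C (m n)" for n
  proof -
    have obs0: "observation A \<xi> (\<epsilon> n) 0 w = (\<lambda>h. \<epsilon> n * \<xi> h w)" for w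
      by (simp add: observation_def A.zero)
    let ?r = "\<integral>w. rejects (F (m n)) (\<lambda>h. \<epsilon> n * \<xi> h w) \<partial>M"
    have "type_I_error M (observation A \<xi> (\<epsilon> n)) (K n) = \<alpha> + (1 - \<alpha>) * ?r"
      using intrej[of n "\<epsilon> n" 0] by (simp add: type_I_error_def K_def obs0 prob_space)
    moreover have "0 \<le> ?r" using rej01 by (intro Bochner_Integration.integral_nonneg) auto
    moreover have "?r \<le> \<epsilon> n * C (m n)"
      unfolding C_def by (rule rejects_errors(1)[OF F(1) \<epsilon>(1)])
    moreover have "(1 - \<alpha>) * ?r \<le> ?r" using \<alpha> \<open>0 \<le> ?r\<close> by (intro mult_left_le_one_le) auto
    ultimately show ?thesis using \<alpha> by (simp add: abs_mult)
  qed
  have typeII: "type_II_error M (observation A \<xi> (\<epsilon> n)) (K n) \<theta> \<le> \<epsilon> n * C (m n)"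
    if \<theta>: "\<rho> n \<le> norm \<theta>" "\<theta> \<in> U" for n \<theta>
  proof -
    obtain h where h: "h \<in> F (m n)" "1 < \<bar>A \<theta> \<bullet> h\<bar>"
      using F(2)[of \<theta> "m n"] \<theta> closure_subset by (auto simp: \<rho>_def)
    let ?r = "\<integral>w. 1 - rejects (F (m n)) (observation A \<xi> (\<epsilon> n) \<theta> w) \<partial>M"
    have "1 - K n y = (1 - \<alpha>) * (1 - rejects (F (m n)) y)" for y
      by (simp add: K_def algebra_simps)
    then have "type_II_error M (observation A \<xi> (\<epsilon> n)) (K n) \<theta> = (1 - \<alpha>) * ?r"
      by (simp add: type_II_error_def)
    also have "\<dots> \<le> ?r"
      using \<alpha> rej01 by (intro mult_left_le_one_le Bochner_Integration.integral_nonneg) auto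
    also have "?r \<le> \<epsilon> n * C (m n)"
      unfolding C_def by (rule rejects_errors(2)) (rule F(1) \<epsilon>(1) h)+
    finally show ?thesis .
  qed
  show thesis
  proof (rule that)
    show "0 < \<rho> n" for n by (simp add: \<rho>_def)
    show "\<rho> \<longlonglongrightarrow> 0"
      unfolding \<rho>_def by (rule filterlim_compose[OF LIMSEQ_inverse_real_of_nat m(1)])
    show "uniformly_consistent M (\<lambda>n. observation A \<xi> (\<epsilon> n)) \<alpha> K (\<lambda>n. {\<theta>. \<rho> n \<le> norm \<theta> \<and> \<theta> \<in> U})"
      unfolding uniformly_consistent_def
    proof (intro conjI allI test)
      have "(\<lambda>n. type_I_error M (observation A \<xi> (\<epsilon> n)) (K n) - \<alpha>) \<longlonglongrightarrow> 0"
        by (rule Lim_null_comparison[OF _ m(2)]) (use typeI in simp)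
      then show "(\<lambda>n. type_I_error M (observation A \<xi> (\<epsilon> n)) (K n)) \<longlonglongrightarrow> \<alpha>"
        by (rule LIM_zero_cancel)
      have "limsup (\<lambda>n. type_II_error_sup M (observation A \<xi> (\<epsilon> n)) (K n) {\<theta>. \<rho> n \<le> norm \<theta> \<and> \<theta> \<in> U})
          \<le> limsup (\<lambda>n. ereal (\<epsilon> n * C (m n)))"
        by (intro Limsup_mono always_eventually allI)
          (auto simp: type_II_error_sup_def typeII intro!: SUP_least)
      also have "\<dots> = ereal 0"
        by (rule lim_imp_Limsup) (use m(2) in \<open>auto intro: tendsto_ereal\<close>)
      also have "\<dots> < ereal (1 - \<alpha>)" using \<alpha> by simp
      finally show "limsup (\<lambda>n. type_II_error_sup M (observation A \<xi> (\<epsilon> n)) (K n)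
          {\<theta>. \<rho> n \<le> norm \<theta> \<and> \<theta> \<in> U}) < ereal (1 - \<alpha>)" .
    qed
  qed
qed

section \<open>Indistinguishability for sets that are not relatively compact\<close>

text \<open>
  Points are chosen one after another; the functionals \<open>x \<mapsto> B (\<theta> j) \<bullet> B x\<close> of the points already
  chosen are made almost zero at the next one.
\<close>

lemma nearly_orthogonal_family:
  fixes B :: "'h \<Rightarrow> 'h"
  assumes ann: "\<And>F \<eta>. finite F \<Longrightarrow> (\<And>\<phi>. \<phi> \<in> F \<Longrightarrow> bounded_linear \<phi>) \<Longrightarrow> 0 < \<eta> \<Longrightarrow>
      \<exists>\<theta>\<in>U. \<rho> \<le> norm \<theta> \<and> (\<forall>\<phi>\<in>F. \<bar>\<phi> \<theta> :: real\<bar> < \<eta>)"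
    and B: "bounded_linear B" and "0 < \<eta>"
  shows "\<exists>\<theta> :: nat \<Rightarrow> 'h. \<forall>i<k. \<theta> i \<in> U \<and> \<rho> \<le> norm (\<theta> i) \<and> (\<forall>j<i. \<bar>B (\<theta> j) \<bullet> B (\<theta> i)\<bar> < \<eta>)"
proof (induction k)
  case (Suc k)
  then obtain \<theta> :: "nat \<Rightarrow> 'h" where
    \<theta>: "\<forall>i<k. \<theta> i \<in> U \<and> \<rho> \<le> norm (\<theta> i) \<and> (\<forall>j<i. \<bar>B (\<theta> j) \<bullet> B (\<theta> i)\<bar> < \<eta>)" by blast
  let ?F = "(\<lambda>j x. B (\<theta> j) \<bullet> B x) ` {..<k}"
  have "bounded_linear (\<lambda>x. B (\<theta> j) \<bullet> B x)" for j
    by (rule bounded_linear_compose[OF bounded_linear_inner_right B])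
  then obtain x where x: "x \<in> U" "\<rho> \<le> norm x" "\<forall>\<phi>\<in>?F. \<bar>\<phi> x\<bar> < \<eta>"
    using ann[of ?F \<eta>] \<open>0 < \<eta>\<close> by auto
  show ?case
    by (rule exI[of _ "\<theta>(k := x)"]) (use \<theta> x in \<open>auto simp: less_Suc_eq\<close>)
qed simp

text \<open>
  If the tests were consistent, then for some \<open>n\<close> the level would be below \<open>\<alpha> + \<delta> / 2\<close> and the power at least
  \<open>\<alpha> + \<delta>\<close> at every alternative of norm at least \<open>\<rho>0\<close>.  The mean power over a long nearly
  orthogonal family of alternatives contradicts the bound on mixtures.
\<close>

lemma compact_of_consistent_tests:
  fixes A B :: "'h \<Rightarrow> 'h"
  assumes B: "bounded_linear B" and A: "\<And>x. A x = S (B x)"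
    and U: "bounded U" "convex U" "zero_inner_point U"
    and \<epsilon>: "\<And>n. 0 < \<epsilon> n" and \<alpha>: "0 < \<alpha>" "\<alpha> < 1" and \<rho>: "\<rho> \<longlonglongrightarrow> 0"
    and cons: "uniformly_consistent M (\<lambda>n. observation A \<xi> (\<epsilon> n)) \<alpha> K
      (\<lambda>n. {\<theta>. \<rho> n \<le> norm \<theta> \<and> \<theta> \<in> U})"
  shows "compact (closure U)"
proof (rule ccontr)
  assume nc: "\<not> compact (closure U)"
  interpret B: bounded_linear B by (rule B)
  obtain r where r: "0 < r" "ball 0 r \<subseteq> closure U"
    using ball_subset_closure_of_absorbing_convex[OF U(2,3)] by blast
  obtain \<rho>0 where "0 < \<rho>0" and ann: "\<And>F \<eta>. finite F \<Longrightarrow> (\<And>\<phi>. \<phi> \<in> F \<Longrightarrow> bounded_linear \<phi>) \<Longrightarrow> 0 < \<eta> \<Longrightarrow>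
      \<exists>\<theta>\<in>U. \<rho>0 \<le> norm \<theta> \<and> (\<forall>\<phi>\<in>F. \<bar>\<phi> \<theta> :: real\<bar> < \<eta>)"
    using almost_annihilated_points[OF nc U(1) r] by blast
  have test: "is_test (K n)" for n
    using cons by (simp add: uniformly_consistent_def)
  have I: "(\<lambda>n. type_I_error M (observation A \<xi> (\<epsilon> n)) (K n)) \<longlonglongrightarrow> \<alpha>"
    and II: "limsup (\<lambda>n. type_II_error_sup M (observation A \<xi> (\<epsilon> n)) (K n)
        {\<theta>. \<rho> n \<le> norm \<theta> \<and> \<theta> \<in> U}) < ereal (1 - \<alpha>)"
    using cons by (auto simp: uniformly_consistent_def)
  obtain c where c: "limsup (\<lambda>n. type_II_error_sup M (observation A \<xi> (\<epsilon> n)) (K n)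
        {\<theta>. \<rho> n \<le> norm \<theta> \<and> \<theta> \<in> U}) < ereal c" "c < 1 - \<alpha>"
    using ereal_dense2[OF II] by auto
  define \<delta> where "\<delta> = 1 - \<alpha> - c"
  have "0 < \<delta>" using c(2) by (simp add: \<delta>_def)
  have "\<forall>\<^sub>F n in sequentially. type_II_error_sup M (observation A \<xi> (\<epsilon> n)) (K n)
        {\<theta>. \<rho> n \<le> norm \<theta> \<and> \<theta> \<in> U} < ereal c
      \<and> type_I_error M (observation A \<xi> (\<epsilon> n)) (K n) < \<alpha> + \<delta> / 2 \<and> \<rho> n < \<rho>0"
    using Limsup_lessD[OF c(1)] order_tendstoD(2)[OF I, of "\<alpha> + \<delta> / 2"] \<open>0 < \<delta>\<close>
      order_tendstoD(2)[OF \<rho> \<open>0 < \<rho>0\<close>] by (auto intro: eventually_conj)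
  then obtain n where n: "type_II_error_sup M (observation A \<xi> (\<epsilon> n)) (K n)
        {\<theta>. \<rho> n \<le> norm \<theta> \<and> \<theta> \<in> U} < ereal c"
      "type_I_error M (observation A \<xi> (\<epsilon> n)) (K n) < \<alpha> + \<delta> / 2" "\<rho> n < \<rho>0"
    by (auto simp: eventually_sequentially)
  define e where "e = \<epsilon> n"
  have "0 < e" by (simp add: e_def \<epsilon>)
  define b where "b x = B ((1 / e) *\<^sub>R x)" for x
  have bl: "bounded_linear b"
    unfolding b_def by (rule bounded_linear_compose[OF B bounded_linear_scaleR_right])
  have obs: "observation A \<xi> e x w = (\<lambda>h. e * (b x \<bullet> S h + \<xi> h w))" for x w
    using \<open>0 < e\<close> by (auto simp: observation_def A b_def B.scaleR S_inner algebra_simps)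
  have obs0: "observation A \<xi> e 0 w = (\<lambda>h. e * \<xi> h w)" for w
    by (simp add: observation_def A B.zero S.zero)
  have power_ge: "\<alpha> + \<delta> \<le> (\<integral>w. K n (\<lambda>h. e * (b x \<bullet> S h + \<xi> h w)) \<partial>M)"
    if "x \<in> U" "\<rho>0 \<le> norm x" for x
  proof -
    have "ereal (type_II_error M (observation A \<xi> (\<epsilon> n)) (K n) x) < ereal c"
    proof (rule le_less_trans[OF _ n(1)])
      show "ereal (type_II_error M (observation A \<xi> (\<epsilon> n)) (K n) x)
          \<le> type_II_error_sup M (observation A \<xi> (\<epsilon> n)) (K n) {\<theta>. \<rho> n \<le> norm \<theta> \<and> \<theta> \<in> U}"
        unfolding type_II_error_sup_def by (rule SUP_upper) (use that n(3) in simp)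
    qed
    then have "(\<integral>w. 1 - K n (observation A \<xi> e x w) \<partial>M) < c"
      by (simp add: type_II_error_def e_def)
    also have "(\<integral>w. 1 - K n (observation A \<xi> e x w) \<partial>M) = 1 - (\<integral>w. K n (observation A \<xi> e x w) \<partial>M)"
      using test_integrable[OF test] by (simp add: prob_space)
    finally show ?thesis by (simp add: obs \<delta>_def)
  qed
  have level: "(\<integral>w. K n (\<lambda>h. e * \<xi> h w) \<partial>M) < \<alpha> + \<delta> / 2"
    using n(2) by (simp add: type_I_error_def obs0 e_def[symmetric])
  obtain L where L: "\<And>x. x \<in> U \<Longrightarrow> norm (b x) \<le> L"
    using bounded_linear_image[OF U(1) bl] by (auto simp: bounded_iff)
  \<comment> \<open>The bound \<open>\<eta>\<close> on the inner products and the length \<open>k\<close> of the family make the two terms of the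
    variance bound equal to \<open>(\<delta> / 4)\<^sup>2\<close> and smaller than it; their sum is below \<open>(\<delta> / 2)\<^sup>2\<close>.\<close>
  define \<eta> where "\<eta> = ln (1 + (\<delta> / 4)\<^sup>2)"
  have "0 < \<eta>" unfolding \<eta>_def using \<open>0 < \<delta>\<close> by (intro ln_gt_zero) simp
  obtain k where k: "exp (L\<^sup>2) / (\<delta> / 4)\<^sup>2 < real k" using reals_Archimedean2 by blast
  moreover have "0 < exp (L\<^sup>2) / (\<delta> / 4)\<^sup>2" using \<open>0 < \<delta>\<close> by simp
  ultimately have "0 < real k" by (rule less_trans[rotated])
  then have "0 < k" by simp
  obtain \<theta> where \<theta>: "\<And>i. i < k \<Longrightarrow> \<theta> i \<in> U" "\<And>i. i < k \<Longrightarrow> \<rho>0 \<le> norm (\<theta> i)"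
      "\<And>i j. i < k \<Longrightarrow> j < i \<Longrightarrow> \<bar>b (\<theta> j) \<bullet> b (\<theta> i)\<bar> < \<eta>"
    using nearly_orthogonal_family[OF ann bl \<open>0 < \<eta>\<close>, of k] by blast
  let ?avg = "(\<Sum>i<k. \<integral>w. K n (\<lambda>h. e * (b (\<theta> i) \<bullet> S h + \<xi> h w)) \<partial>M) / k"
  have "(?avg - (\<integral>w. K n (\<lambda>h. e * \<xi> h w) \<partial>M))\<^sup>2 \<le> exp (L\<^sup>2) / k + (exp \<eta> - 1)"
  proof (rule mixture_of_shifts[OF _ _ _ \<open>0 < k\<close>])
    show "K n \<in> borel_measurable (PiM UNIV (\<lambda>_. borel))" "0 \<le> K n y" "K n y \<le> 1" for y
      using test[of n] by (auto simp: is_test_def)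
    show "(norm (b (\<theta> i)))\<^sup>2 \<le> L\<^sup>2" if "i < k" for i
      using L[OF \<theta>(1)[OF that]] by (intro power_mono) auto
    show "b (\<theta> i) \<bullet> b (\<theta> j) \<le> \<eta>" if "i < k" "j < k" "i \<noteq> j" for i j
      using \<theta>(3)[of i j] \<theta>(3)[of j i] that
      by (cases "i < j") (auto simp: inner_commute)
  qed
  also have "\<dots> < (\<delta> / 4)\<^sup>2 + (\<delta> / 4)\<^sup>2"
  proof -
    have "exp (L\<^sup>2) / k < (\<delta> / 4)\<^sup>2" using k \<open>0 < k\<close> \<open>0 < \<delta>\<close> by (simp add: field_simps)
    moreover have "exp \<eta> - 1 = (\<delta> / 4)\<^sup>2"
      using \<open>0 < \<delta>\<close> by (simp add: \<eta>_def add_pos_nonneg)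
    ultimately show ?thesis by simp
  qed
  also have "\<dots> \<le> (\<delta> / 2)\<^sup>2" by (simp add: power2_eq_square)
  finally have "?avg - (\<integral>w. K n (\<lambda>h. e * \<xi> h w) \<partial>M) < \<delta> / 2"
    by (rule power_less_imp_less_base) (use \<open>0 < \<delta>\<close> in simp)
  moreover have "\<alpha> + \<delta> \<le> ?avg"
  proof -
    have "(\<Sum>i<k. \<alpha> + \<delta>) \<le> (\<Sum>i<k. \<integral>w. K n (\<lambda>h. e * (b (\<theta> i) \<bullet> S h + \<xi> h w)) \<partial>M)"
      by (intro sum_mono power_ge \<theta>) auto
    then show ?thesis using \<open>0 < k\<close> by (simp add: field_simps)
  qed
  ultimately show False using level by linarith
qed

end

theorem theorem3p3:
  fixes A R :: "'h::{real_inner, complete_space} \<Rightarrow> 'h"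
    and U :: "'h set"
    and \<epsilon> :: "nat \<Rightarrow> real"
    and M :: "'w measure"
    and \<xi> :: "'h \<Rightarrow> 'w \<Rightarrow> real"
    and \<alpha> :: real
  assumes "prob_space M"
    and "gaussian_vector M \<xi>"
    and "mean_zero M \<xi>"
    and "covariance_operator M \<xi> R"
    and "\<And>n. 0 < \<epsilon> n"
    and "\<epsilon> \<longlonglongrightarrow> 0"
    and "linear A"
    and "{x. A x = 0} = {0}"
    and "{x. R x = 0} = {0}"
    and "range A \<subseteq> range (operator_sqrt R)"
    and "bounded_linear (inv (operator_sqrt R) \<circ> A)"
    and "bounded U"
    and "convex U"
    and "zero_inner_point U"
    and "0 < \<alpha>" and "\<alpha> < 1"
  shows "(\<exists>\<rho> :: nat \<Rightarrow> real. (\<forall>n. 0 < \<rho> n) \<and> \<rho> \<longlonglongrightarrow> 0 \<and>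
            (\<exists>K. uniformly_consistent M (\<lambda>n. observation A \<xi> (\<epsilon> n)) \<alpha> K
                   (\<lambda>n. {\<theta>. \<rho> n \<le> norm \<theta> \<and> \<theta> \<in> U})))
         \<longleftrightarrow> compact (closure U)"
proof -
  interpret gaussian_field M \<xi> "operator_sqrt R"
    by (rule gaussian_field_of_covariance) fact+
  let ?B = "inv (operator_sqrt R) \<circ> A"
  have A: "A x = operator_sqrt R (?B x)" for x
  proof -
    have "A x \<in> range (operator_sqrt R)" using assms(10) by blast
    then show ?thesis by (simp add: f_inv_into_f)
  qed
  then have "A = operator_sqrt R \<circ> ?B" by (auto simp: fun_eq_iff)
  then have "bounded_linear A"
    using bounded_linear_compose[OF S.bounded_linear_axioms assms(11)] by (simp add: comp_def)
  show ?thesis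
  proof
    assume "compact (closure U)"
    then obtain \<rho> K where "\<And>n. 0 < \<rho> n" "\<rho> \<longlonglongrightarrow> 0" "uniformly_consistent M
        (\<lambda>n. observation A \<xi> (\<epsilon> n)) \<alpha> K (\<lambda>n. {\<theta>. \<rho> n \<le> norm \<theta> \<and> \<theta> \<in> U})"
      using consistent_tests_of_compact[OF \<open>bounded_linear A\<close> assms(8) _ assms(5,6,15,16)] by blast
    then show "\<exists>\<rho> :: nat \<Rightarrow> real. (\<forall>n. 0 < \<rho> n) \<and> \<rho> \<longlonglongrightarrow> 0 \<and>
            (\<exists>K. uniformly_consistent M (\<lambda>n. observation A \<xi> (\<epsilon> n)) \<alpha> K
                   (\<lambda>n. {\<theta>. \<rho> n \<le> norm \<theta> \<and> \<theta> \<in> U}))" by blast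
  next
    assume "\<exists>\<rho> :: nat \<Rightarrow> real. (\<forall>n. 0 < \<rho> n) \<and> \<rho> \<longlonglongrightarrow> 0 \<and>
            (\<exists>K. uniformly_consistent M (\<lambda>n. observation A \<xi> (\<epsilon> n)) \<alpha> K
                   (\<lambda>n. {\<theta>. \<rho> n \<le> norm \<theta> \<and> \<theta> \<in> U}))"
    then show "compact (closure U)"
      using compact_of_consistent_tests[where \<epsilon> = \<epsilon>, OF assms(11) A assms(12-14,5,15,16)] by blast
  qed
qed

end
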